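(* Let $1\leq p<\infty$ and let $\mathcal{T}$ be the operator defined by $$\mathcal{T}(f)(z)=\int_{z}^{\infty}\frac{f(\zeta)}{\zeta}\,d\zeta,\qquad f\in H^{p}(\mathbb{U}),\ z\in\mathbb{U}.$$ Then $\mathcal{T}:H^p(\mathbb{U})\to H^p(\mathbb{U})$ is bounded. Further, its operator norm is $$\Vert\mathcal{T}\Vert=p,$$ and its spectrum is $$\sigma(\mathcal{T})=\Bigl\{w\in\mathbb{C}:\Bigl|w-\frac{p}{2}\Bigr|=\frac{p}{2}\Bigr\}.$$
   Context: $\mathbb{U}=\{z\in\mathbb{C}:\mathrm{Im}(z)>0\}$ is the upper half-plane. For $0<p<\infty$, the Hardy space $H^p(\mathbb{U})$ is the space of analytic functions $f:\mathbb{U}\to\mathbb{C}$ with $$\Vert f\Vert_p=\sup_{y>0}\Bigl(\int_{-\infty}^{\infty}|f(x+iy)|^p\,dx\Bigr)^{1/p}<\infty ;$$ it is a complex Banach space for $1\le p<\infty$. In the definition of $\mathcal{T}$, $\int_z^\infty \frac{f(\zeta)}{\zeta}\,d\zeta$ means $\lim_{w\to\infty,\ w\in\mathbb{U}}\int_z^w\frac{f(\zeta)}{\zeta}\,d\zeta$, the unrestricted limit as $w\to\infty$ within $\mathbb{U}$, where $\int_z^w$ is the integral along any path in $\mathbb{U}$ from $z$ to $w$. $\sigma(A)$ denotes the spectrum of an operator $A$ on $H^p(\mathbb{U})$. *)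

theory Defs
  imports "HOL-Complex_Analysis.Complex_Analysis"
begin

definition upper_half_plane :: "complex set" where
  "upper_half_plane = {z. Im z > 0}"

text \<open>
  The \<open>p\<close>-norm of \<open>f\<close> on the horizontal line at height \<open>y\<close>, and its supremum over \<open>y > 0\<close>. These are
  the intended quantities only if the integrals converge and are bounded in \<open>y\<close>, which
  membership in \<open>hardy_space p\<close> demands.
\<close>

definition hardy_line_norm :: "real \<Rightarrow> (complex \<Rightarrow> complex) \<Rightarrow> real \<Rightarrow> real" where
  "hardy_line_norm p f y = (LINT x|lborel. cmod (f (Complex x y)) powr p) powr (1 / p)"

definition hardy_norm :: "real \<Rightarrow> (complex \<Rightarrow> complex) \<Rightarrow> real" where
  "hardy_norm p f = (SUP y\<in>{0<..}. hardy_line_norm p f y)"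

text \<open>
  A function on the half-plane is represented by its extension by \<open>0\<close> to all of \<open>\<complex>\<close>, so that
  equality of HOL functions is equality on the half-plane.
\<close>

definition hardy_space :: "real \<Rightarrow> (complex \<Rightarrow> complex) set" where
  "hardy_space p = {f. f holomorphic_on upper_half_plane
      \<and> (\<forall>z. z \<notin> upper_half_plane \<longrightarrow> f z = 0)
      \<and> (\<forall>y>0. integrable lborel (\<lambda>x. cmod (f (Complex x y)) powr p))
      \<and> bdd_above (hardy_line_norm p f ` {0<..})}"

definition hardy_bounded_operator ::
    "real \<Rightarrow> ((complex \<Rightarrow> complex) \<Rightarrow> (complex \<Rightarrow> complex)) \<Rightarrow> bool" where
  "hardy_bounded_operator p A \<longleftrightarrow>
      (\<forall>f\<in>hardy_space p. A f \<in> hardy_space p)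
    \<and> (\<forall>f\<in>hardy_space p. \<forall>g\<in>hardy_space p. A (\<lambda>z. f z + g z) = (\<lambda>z. A f z + A g z))
    \<and> (\<forall>c. \<forall>f\<in>hardy_space p. A (\<lambda>z. c * f z) = (\<lambda>z. c * A f z))
    \<and> (\<exists>C. \<forall>f\<in>hardy_space p. hardy_norm p (A f) \<le> C * hardy_norm p f)"

definition hardy_operator_norm ::
    "real \<Rightarrow> ((complex \<Rightarrow> complex) \<Rightarrow> (complex \<Rightarrow> complex)) \<Rightarrow> real" where
  "hardy_operator_norm p A =
    (SUP f\<in>{f \<in> hardy_space p. hardy_norm p f \<le> 1}. hardy_norm p (A f))"

text \<open>\<open>w\<close> is in the spectrum iff \<open>w I - A\<close> has no bounded two-sided inverse \<open>R\<close> on the Hardy space.\<close>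

definition hardy_spectrum ::
    "real \<Rightarrow> ((complex \<Rightarrow> complex) \<Rightarrow> (complex \<Rightarrow> complex)) \<Rightarrow> complex set" where
  "hardy_spectrum p A = {w. \<not> (\<exists>R. hardy_bounded_operator p R
      \<and> (\<forall>f\<in>hardy_space p. R (\<lambda>z. w * f z - A f z) = f
                          \<and> (\<lambda>z. w * R f z - A (R f) z) = f))}"

text \<open>\<open>w \<longlongrightarrow> \<infinity>\<close> within the half-plane, with no restriction on the direction.\<close>

definition at_infinity_upper :: "complex filter" where
  "at_infinity_upper = inf at_infinity (principal upper_half_plane)"

text \<open>
  The integral from \<open>z\<close> to \<open>w\<close> is taken along the segment, which lies in the convex half-plane;
  the lemma \<open>path_integral_eq_segment_integral\<close> below shows that any other path
  in the half-plane gives the same value.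
\<close>

definition hardy_T :: "(complex \<Rightarrow> complex) \<Rightarrow> complex \<Rightarrow> complex" where
  "hardy_T f z =
    (if z \<in> upper_half_plane
     then Lim at_infinity_upper (\<lambda>w. contour_integral (linepath z w) (\<lambda>\<zeta>. f \<zeta> / \<zeta>))
     else 0)"

text \<open>Since the filter is nontrivial, limits along it are unique and \<open>Lim\<close> picks them out.\<close>

lemma at_infinity_upper_neq_bot: "at_infinity_upper \<noteq> bot"
proof
  assume "at_infinity_upper = bot"
  then have "eventually (\<lambda>_. False) at_infinity_upper"
    by simp
  then obtain b where b: "\<And>x. b \<le> cmod x \<Longrightarrow> x \<notin> upper_half_plane"
    unfolding at_infinity_upper_def eventually_inf_principal eventually_at_infinity by auto
  have "b \<le> cmod (Complex 0 (\<bar>b\<bar> + 1))"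
    by (simp add: cmod_def)
  from b[OF this] show False
    by (simp add: upper_half_plane_def)
qed

lemma path_integral_eq_segment_integral:
  assumes f: "f holomorphic_on upper_half_plane"
    and \<gamma>: "valid_path \<gamma>" "path_image \<gamma> \<subseteq> upper_half_plane"
      "pathstart \<gamma> = z" "pathfinish \<gamma> = w"
  shows "(\<lambda>\<zeta>. f \<zeta> / \<zeta>) contour_integrable_on \<gamma>"
    and "contour_integral \<gamma> (\<lambda>\<zeta>. f \<zeta> / \<zeta>) = contour_integral (linepath z w) (\<lambda>\<zeta>. f \<zeta> / \<zeta>)"
proof -
  let ?g = "\<lambda>\<zeta>. f \<zeta> / \<zeta>"
  have op: "open upper_half_plane" and cv: "convex upper_half_plane"
    unfolding upper_half_plane_def
    by (auto simp: open_halfspace_Im_gt convex_halfspace_Im_gt)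
  have g: "?g holomorphic_on upper_half_plane"
    by (intro holomorphic_intros f) (auto simp: upper_half_plane_def)
  obtain F where F:
    "\<And>x. x \<in> upper_half_plane \<Longrightarrow> (F has_field_derivative ?g x) (at x within upper_half_plane)"
    using holomorphic_convex_primitive'[OF cv op g] by blast
  have zw: "z \<in> upper_half_plane" "w \<in> upper_half_plane"
    using \<gamma> pathstart_in_path_image pathfinish_in_path_image by blast+
  have a: "(?g has_contour_integral (F w - F z)) \<gamma>"
    using contour_integral_primitive[OF F \<gamma>(1,2)] \<gamma>(3,4) by simp
  have seg: "path_image (linepath z w) \<subseteq> upper_half_plane"
    using zw cv by (simp add: closed_segment_subset)
  have b: "(?g has_contour_integral (F w - F z)) (linepath z w)"
    using contour_integral_primitive[OF F _ seg] by simp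
  show "?g contour_integrable_on \<gamma>"
    using a by (auto simp: contour_integrable_on_def)
  show "contour_integral \<gamma> ?g = contour_integral (linepath z w) ?g"
    using a b by (simp add: contour_integral_unique)
qed

end

theory Submission
  imports Defs "HOL-Probability.Distributions"
begin

text \<open>
  The dilations \<open>S\<^sub>s f (z) = f (e\<^sup>s z)\<close> multiply the norm of \<open>H\<^sup>p\<close> by \<open>exp (- s / p)\<close>, and
  integrating along the ray through \<open>z\<close> gives \<open>T f = \<integral>\<^sub>0\<^sup>\<infinity> S\<^sub>s f ds\<close>. Hence
  \<open>\<parallel>T\<parallel> \<le> \<integral>\<^sub>0\<^sup>\<infinity> exp (- s / p) ds = p\<close>. The generator of the dilation group is the Euler operator
  \<open>f \<mapsto> z f'\<close>, its spectrum is the line \<open>Re = - 1 / p\<close>, and \<open>T\<close> is minus its inverse. The map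
  \<open>\<lambda> \<mapsto> - 1 / \<lambda>\<close> carries that line, together with \<open>\<infinity>\<close>, onto the circle of the theorem.

  Semigroup theory is avoided by arguing throughout with the Euler equation \<open>z g' + a g = f\<close>.
  For \<open>Re a \<noteq> 1 / p\<close> it has at most one solution in \<open>H\<^sup>p\<close> (\<open>hardy_euler_unique\<close>), because a
  solution of the homogeneous equation is homogeneous of degree \<open>- a\<close> along rays, which
  contradicts the growth bound \<open>\<bar>f z\<bar> \<le> C (Im z) powr (- 1 / p)\<close> (\<open>hardy_bound_pointwise\<close>)
  either at \<open>0\<close> or at \<open>\<infinity>\<close>. It has a solution with \<open>\<parallel>g\<parallel> \<le> \<parallel>f\<parallel> / \<bar>1 / p - Re a\<bar>\<close>
  (\<open>hardy_euler_exists\<close>), an integral over the part of the ray beyond \<open>z\<close> or before \<open>z\<close>,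
  according to the sign of \<open>1 / p - Re a\<close>. The case \<open>a = 0\<close> is \<open>- T f\<close>. Uniqueness reduces every
  operator identity to checking a differential equation: linearity of \<open>T\<close>, and the fact that for
  \<open>a = 1 / w\<close> off the circle \<open>f \<mapsto> a f - a\<^sup>2 g\<close> inverts \<open>w - T\<close>.

  For the lower bound on the norm and for the points of the circle, the functions
  \<open>k z = z\<^sup>-\<^sup>a (z / (z + \<i>)\<^sup>2)\<^sup>\<delta>\<close> with \<open>Re a = 1 / p\<close> and small \<open>\<delta> > 0\<close> lie in \<open>H\<^sup>p\<close> and satisfy
  \<open>\<bar>z k' + a k\<bar> \<le> \<delta> \<bar>k\<bar>\<close> pointwise. For \<open>f = z k'\<close> this means \<open>T f = - k\<close> and \<open>f \<approx> - a k\<close>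
  (\<open>hardy_T_near_eigenfunction\<close>). With \<open>a = 1 / p\<close> the quotient \<open>\<parallel>T f\<parallel> / \<parallel>f\<parallel>\<close> tends to \<open>p\<close>. With
  \<open>a = 1 / w\<close> the quotient \<open>\<parallel>(w - T) f\<parallel> / \<parallel>f\<parallel>\<close> tends to \<open>0\<close>, so \<open>w - T\<close> has no bounded inverse.
  With \<open>\<bar>Im a\<bar> \<rightarrow> \<infinity>\<close> the same happens for \<open>w = 0\<close>.
\<close>

section \<open>Norm bounds in the Hardy space\<close>

lemma mem_upper_half_plane [simp]: "z \<in> upper_half_plane \<longleftrightarrow> 0 < Im z"
  by (simp add: upper_half_plane_def)

lemma open_upper_half_plane: "open upper_half_plane"
  by (simp add: upper_half_plane_def open_halfspace_Im_gt)

lemma convex_upper_half_plane: "convex upper_half_plane"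
  by (simp add: upper_half_plane_def convex_halfspace_Im_gt)

lemma upper_half_plane_primitive:
  assumes "f holomorphic_on upper_half_plane"
  obtains F where "\<And>z. 0 < Im z \<Longrightarrow> (F has_field_derivative f z) (at z)"
proof -
  from holomorphic_convex_primitive'[OF convex_upper_half_plane open_upper_half_plane assms]
  obtain F where "\<And>z. z \<in> upper_half_plane \<Longrightarrow>
      (F has_field_derivative f z) (at z within upper_half_plane)" by blast
  then show ?thesis
    using that at_within_open[OF _ open_upper_half_plane] by (metis mem_upper_half_plane)
qed

text \<open>
  For \<open>p > 0\<close> this says that \<open>f\<close> lies in \<open>H\<^sup>p\<close> and has norm at most \<open>N\<close> (\<open>hardy_bound_iff\<close>). It
  bounds \<open>p\<close>-th powers of line norms, so that estimates need neither suprema nor roots.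
\<close>

definition hardy_bound :: "real \<Rightarrow> (complex \<Rightarrow> complex) \<Rightarrow> real \<Rightarrow> bool" where
  "hardy_bound p f N \<longleftrightarrow> f holomorphic_on upper_half_plane \<and> (\<forall>z. \<not> 0 < Im z \<longrightarrow> f z = 0) \<and> 0 \<le> N
    \<and> (\<forall>y>0. integrable lborel (\<lambda>x. cmod (f (Complex x y)) powr p)
             \<and> (LINT x|lborel. cmod (f (Complex x y)) powr p) \<le> N powr p)"

lemma hardy_boundD:
  assumes "hardy_bound p f N"
  shows "f holomorphic_on upper_half_plane" "\<not> 0 < Im z \<Longrightarrow> f z = 0" "0 \<le> N"
    "0 < y \<Longrightarrow> integrable lborel (\<lambda>x. cmod (f (Complex x y)) powr p)"
    "0 < y \<Longrightarrow> (LINT x|lborel. cmod (f (Complex x y)) powr p) \<le> N powr p"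
  using assms by (auto simp: hardy_bound_def)

lemma hardy_line_norm_nonneg: "0 \<le> hardy_line_norm p f y"
  by (simp add: hardy_line_norm_def)

lemma hardy_line_norm_powr:
  assumes "0 < p"
  shows "hardy_line_norm p f y powr p = (LINT x|lborel. cmod (f (Complex x y)) powr p)"
proof -
  have "0 \<le> (LINT x|lborel. cmod (f (Complex x y)) powr p)"
    by (intro integral_nonneg_AE) auto
  then show ?thesis
    using assms by (simp add: hardy_line_norm_def powr_powr)
qed

lemma hardy_bound_iff:
  assumes "0 < p"
  shows "hardy_bound p f N \<longleftrightarrow> f \<in> hardy_space p \<and> hardy_norm p f \<le> N"
proof -
  have line: "(LINT x|lborel. cmod (f (Complex x y)) powr p) \<le> N powr p \<longleftrightarrow> hardy_line_norm p f y \<le> N"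
    if "0 \<le> N" for y
    unfolding hardy_line_norm_powr[OF assms, symmetric]
    using that assms hardy_line_norm_nonneg powr_mono2 powr_less_mono2
    by (metis less_eq_real_def linorder_not_le)
  show ?thesis
  proof
    assume h: "hardy_bound p f N"
    then have le: "hardy_line_norm p f y \<le> N" if "0 < y" for y
      using line that by (auto simp: hardy_bound_def)
    then have "bdd_above (hardy_line_norm p f ` {0<..})"
      by (auto intro!: bdd_aboveI2)
    moreover have "hardy_norm p f \<le> N"
      unfolding hardy_norm_def by (rule cSUP_least) (auto intro: le)
    ultimately show "f \<in> hardy_space p \<and> hardy_norm p f \<le> N"
      using h by (auto simp: hardy_space_def hardy_bound_def)
  next
    assume h: "f \<in> hardy_space p \<and> hardy_norm p f \<le> N"
    have le: "hardy_line_norm p f y \<le> N" if "0 < y" for y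
    proof -
      have "hardy_line_norm p f y \<le> hardy_norm p f"
        unfolding hardy_norm_def by (rule cSUP_upper) (use h that in \<open>auto simp: hardy_space_def\<close>)
      with h show ?thesis by simp
    qed
    have "0 \<le> N"
      using le[of 1] hardy_line_norm_nonneg[of p f 1] by linarith
    with h le line show "hardy_bound p f N"
      by (auto simp: hardy_space_def hardy_bound_def)
  qed
qed

lemma hardy_norm_nonneg:
  assumes "0 < p" "f \<in> hardy_space p"
  shows "0 \<le> hardy_norm p f"
  using hardy_bound_iff[of p f "hardy_norm p f"] assms by (auto dest: hardy_boundD)

lemma continuous_on_line:
  assumes "f holomorphic_on upper_half_plane" "0 < y"
  shows "continuous_on UNIV (\<lambda>x. f (Complex x y))"
proof -
  have "continuous_on UNIV (\<lambda>x. Complex x y)"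
    unfolding Complex_eq by (intro continuous_intros)
  moreover have "continuous_on upper_half_plane f"
    using assms(1) by (rule holomorphic_on_imp_continuous_on)
  ultimately show ?thesis
    by (intro continuous_on_compose2[of upper_half_plane f UNIV]) (use assms in auto)
qed

lemma measurable_line_powr:
  assumes "f holomorphic_on upper_half_plane" "0 < y"
  shows "(\<lambda>x. cmod (f (Complex x y)) powr p) \<in> borel_measurable borel"
proof -
  have "(\<lambda>x. f (Complex x y)) \<in> borel_measurable borel"
    using continuous_on_line[OF assms] by (rule borel_measurable_continuous_onI)
  then show ?thesis by measurable
qed

text \<open>
  The majorant is allowed to fail on a null set because the one for the almost eigenfunctions
  below is singular at \<open>x = 0\<close>, where its formula evaluates to \<open>0\<close>.
\<close>

lemma hardy_bound_if_le_integrable: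
  assumes f: "f holomorphic_on upper_half_plane" "\<And>z. \<not> 0 < Im z \<Longrightarrow> f z = 0" and N: "0 \<le> N"
    and u: "\<And>y. 0 < y \<Longrightarrow> integrable lborel (u y)" "\<And>y. 0 < y \<Longrightarrow> integral\<^sup>L lborel (u y) \<le> N powr p"
    and le: "\<And>y. 0 < y \<Longrightarrow> AE x in lborel. cmod (f (Complex x y)) powr p \<le> u y x"
  shows "hardy_bound p f N"
  unfolding hardy_bound_def
proof (intro conjI allI impI)
  fix y :: real assume y: "0 < y"
  have meas: "(\<lambda>x. cmod (f (Complex x y)) powr p) \<in> borel_measurable lborel"
    using measurable_line_powr[OF f(1) y] by simp
  show i: "integrable lborel (\<lambda>x. cmod (f (Complex x y)) powr p)"
    by (rule Bochner_Integration.integrable_bound[OF u(1)[OF y] meas])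
        (use le[OF y] in eventually_elim, simp)
  have "(LINT x|lborel. cmod (f (Complex x y)) powr p) \<le> integral\<^sup>L lborel (u y)"
    by (rule integral_mono_AE[OF i u(1)[OF y] le[OF y]])
  with u(2)[OF y] show "(LINT x|lborel. cmod (f (Complex x y)) powr p) \<le> N powr p"
    by linarith
qed (use f N in auto)

lemma hardy_bound_dominated:
  assumes f: "hardy_bound p f N" and g: "g holomorphic_on upper_half_plane"
      "\<And>z. \<not> 0 < Im z \<Longrightarrow> g z = 0"
    and le: "\<And>z. 0 < Im z \<Longrightarrow> cmod (g z) \<le> c * cmod (f z)" and c: "0 \<le> c" and p: "0 < p"
  shows "hardy_bound p g (c * N)"
proof (rule hardy_bound_if_le_integrable[where u =
    "\<lambda>y x. c powr p * cmod (f (Complex x y)) powr p"])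
  fix y :: real assume y: "0 < y"
  have "cmod (g (Complex x y)) powr p \<le> c powr p * cmod (f (Complex x y)) powr p" for x
  proof -
    have "cmod (g (Complex x y)) powr p \<le> (c * cmod (f (Complex x y))) powr p"
      using p le y by (intro powr_mono2) auto
    then show ?thesis
      using c by (simp add: powr_mult)
  qed
  then show "AE x in lborel. cmod (g (Complex x y)) powr p
      \<le> c powr p * cmod (f (Complex x y)) powr p"
    by simp
next
  fix y :: real assume "0 < y"
  then show "(LINT x|lborel. c powr p * cmod (f (Complex x y)) powr p) \<le> (c * N) powr p"
    using hardy_boundD[OF f] c by (simp add: powr_mult mult_left_mono)
qed (use g hardy_boundD[OF f] c in auto)

text \<open>
  A crude form of Minkowski's inequality. It serves to see that sums stay in the space and that
  the inverse of \<open>w - T\<close> found below is bounded, where the constant is immaterial.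
\<close>

lemma hardy_bound_add:
  assumes f: "hardy_bound p f M" and g: "hardy_bound p g N" and p: "1 \<le> p"
  shows "hardy_bound p (\<lambda>z. f z + g z) (4 * max M N)"
proof (rule hardy_bound_if_le_integrable[where u =
    "\<lambda>y x. 2 powr p * (cmod (f (Complex x y)) powr p + cmod (g (Complex x y)) powr p)"])
  fix y :: real
  have "cmod (f z + g z) powr p \<le> 2 powr p * (cmod (f z) powr p + cmod (g z) powr p)" for z
  proof -
    have "cmod (f z + g z) \<le> 2 * max (cmod (f z)) (cmod (g z))"
      using norm_triangle_ineq[of "f z" "g z"] by linarith
    then have "cmod (f z + g z) powr p \<le> (2 * max (cmod (f z)) (cmod (g z))) powr p"
      using p by (intro powr_mono2) auto
    also have "\<dots> \<le> 2 powr p * (cmod (f z) powr p + cmod (g z) powr p)"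
      by (simp add: powr_mult max_def)
    finally show ?thesis .
  qed
  then show "AE x in lborel. cmod (f (Complex x y) + g (Complex x y)) powr p
      \<le> 2 powr p * (cmod (f (Complex x y)) powr p + cmod (g (Complex x y)) powr p)"
    by simp
next
  fix y :: real assume y: "0 < y"
  have MN: "0 \<le> M" "0 \<le> N" using hardy_boundD f g by auto
  have "(LINT x|lborel. 2 powr p * (cmod (f (Complex x y)) powr p + cmod (g (Complex x y)) powr p))
      = 2 powr p * ((LINT x|lborel. cmod (f (Complex x y)) powr p)
          + (LINT x|lborel. cmod (g (Complex x y)) powr p))"
    using hardy_boundD(4)[OF f y] hardy_boundD(4)[OF g y] by simp
  also have "\<dots> \<le> 2 powr p * (max M N powr p + max M N powr p)"
    using MN p by (intro mult_left_mono add_mono order_trans[OF hardy_boundD(5)[OF f y]]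
        order_trans[OF hardy_boundD(5)[OF g y]] powr_mono2) auto
  also have "\<dots> \<le> 2 powr p * (2 powr p * max M N powr p)"
    using powr_mono[of 1 p 2] p by (intro mult_left_mono) (auto intro!: mult_right_mono)
  also have "\<dots> = (4 * max M N) powr p"
    using MN by (simp add: powr_mult[symmetric])
  finally show "(LINT x|lborel. 2 powr p * (cmod (f (Complex x y)) powr p
      + cmod (g (Complex x y)) powr p)) \<le> (4 * max M N) powr p" .
qed (use hardy_boundD[OF f] hardy_boundD[OF g] in \<open>auto intro!: holomorphic_intros\<close>)

section \<open>Growth of functions in the Hardy space\<close>

text \<open>
  Either \<open>u \<le> c\<close>, or \<open>u = u powr (1 - p) * u powr p\<close> with a decreasing first factor. Integrating
  this and optimizing over \<open>c\<close> replaces Hoelder's inequality at the price of a factor \<open>2\<close>.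
\<close>

lemma le_young_powr:
  fixes u c p :: real
  assumes "0 < c" "0 \<le> u" "1 \<le> p"
  shows "u \<le> c + c powr (1 - p) * u powr p"
proof (cases "u \<le> c")
  case True
  then show ?thesis by (simp add: add_increasing2)
next
  case False
  then have u: "c < u" by simp
  have "u powr (1 - p) \<le> c powr (1 - p)"
    using assms u by (intro powr_mono2') auto
  then have "u powr (1 - p) * u powr p \<le> c powr (1 - p) * u powr p"
    by (intro mult_right_mono) auto
  moreover have "u powr (1 - p) * u powr p = u"
    using assms u by (simp add: powr_add[symmetric])
  ultimately show ?thesis using assms by linarith
qed

lemma integral_segment_le:
  assumes f: "hardy_bound p f N" and N: "0 < N" and p: "1 \<le> p" and y: "0 < y" and uv: "u < v"
  shows "integral {u..v} (\<lambda>t. cmod (f (Complex t y))) \<le> 2 * N * (v - u) powr (1 - 1/p)"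
proof -
  \<comment> \<open>this \<open>c\<close> balances the two terms of \<open>le_young_powr\<close> after integration\<close>
  define h c where "h = v - u" and "c = N * h powr (- (1/p))"
  have h: "0 < h" and c: "0 < c" using N uv by (auto simp: h_def c_def)
  let ?F = "\<lambda>t. cmod (f (Complex t y)) powr p"
  note cont = continuous_on_subset[OF continuous_on_line[OF hardy_boundD(1)[OF f] y] subset_UNIV]
  have i1: "(\<lambda>t. cmod (f (Complex t y))) integrable_on {u..v}"
    by (intro integrable_continuous_real continuous_intros cont)
  have sI: "set_integrable lborel {u..v} ?F"
    by (rule set_integrable_subset[of _ UNIV]) (use hardy_boundD(4)[OF f y] in \<open>auto simp:
        set_integrable_def\<close>)
  have i2: "?F integrable_on {u..v}" and e2: "integral {u..v} ?F = (LINT t:{u..v}|lborel. ?F t)"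
    using set_borel_integral_eq_integral[OF sI] by auto
  have "(LINT t:{u..v}|lborel. ?F t) \<le> (LINT t|lborel. ?F t)"
    unfolding set_lebesgue_integral_def
    by (intro integral_mono sI[unfolded set_integrable_def] hardy_boundD(4)[OF f y])
       (auto simp: indicator_def)
  then have I: "integral {u..v} ?F \<le> N powr p"
    using e2 hardy_boundD(5)[OF f y] by linarith
  have "integral {u..v} (\<lambda>t. cmod (f (Complex t y))) \<le> integral {u..v} (\<lambda>t. c
      + c powr (1 - p) * ?F t)"
    using i2 by (intro integral_le i1 le_young_powr c p integrable_add integrable_on_mult_right
        integrable_const_ivl) auto
  also have "\<dots> = c * h + c powr (1 - p) * integral {u..v} ?F"
    using i2 uv by (subst integral_add) (auto intro!: integrable_on_mult_right simp: h_def)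
  also have "\<dots> \<le> c * h + c powr (1 - p) * N powr p"
    using I by (simp add: mult_left_mono)
  also have "c powr (1 - p) * N powr p = N * h powr (1 - 1/p)"
  proof -
    have "c powr (1 - p) = N powr (1 - p) * h powr (- (1/p) * (1 - p))"
      using N h by (simp add: c_def powr_mult powr_powr)
    moreover have "- (1/p) * (1 - p) = 1 - 1/p" using p by (simp add: field_simps)
    moreover have "N powr (1 - p) * N powr p = N" using N by (simp add: powr_add[symmetric])
    ultimately show ?thesis by (simp add: algebra_simps)
  qed
  also have "c * h = N * h powr (1 - 1/p)"
    using h by (simp add: c_def powr_diff powr_minus field_simps)
  finally show ?thesis by (simp add: h_def)
qed

text \<open>
  If \<open>f\<close> stayed above \<open>m\<close> on a segment of length \<open>v - u\<close>, its line integral would be at least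
  \<open>m powr p * (v - u)\<close>. So \<open>f\<close> is small somewhere on the segment, and \<open>w\<close> is near that value.
\<close>

lemma cmod_le_oscillation:
  assumes f: "hardy_bound p f N" and p: "1 \<le> p" and y: "0 < y" and uv: "u < v"
    and E: "\<And>t. t \<in> {u..v} \<Longrightarrow> cmod (w - f (Complex t y)) \<le> E"
  shows "cmod w \<le> E + N * (v - u) powr (- (1/p))"
proof (rule ccontr)
  assume "\<not> ?thesis"
  then have m: "N * (v - u) powr (- (1/p)) < cmod w - E" by simp
  define m where "m = cmod w - E"
  have mge: "0 \<le> N * (v - u) powr (- (1/p))" using hardy_boundD(3)[OF f] by simp
  have le: "m \<le> cmod (f (Complex t y))" if "t \<in> {u..v}" for t
    using E[OF that] norm_triangle_ineq2[of w "f (Complex t y)"] by (simp add: m_def)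
  have "m powr p * (v - u) = (LINT t|lborel. indicator {u..v} t * m powr p)"
    using uv by simp
  also have "\<dots> \<le> (LINT t|lborel. cmod (f (Complex t y)) powr p)"
  proof (intro integral_mono hardy_boundD(4)[OF f y])
    show "indicator {u..v} t * m powr p \<le> cmod (f (Complex t y)) powr p" for t
      using le m mge p by (auto simp: indicator_def m_def intro!: powr_mono2)
  qed (use uv in simp)
  also have "\<dots> \<le> N powr p" by (rule hardy_boundD(5)[OF f y])
  finally have 1: "m powr p * (v - u) \<le> N powr p" .
  have "(N * (v - u) powr (- (1/p))) powr p < m powr p"
    using m mge p by (intro powr_less_mono2) (auto simp: m_def)
  moreover have "(N * (v - u) powr (- (1/p))) powr p = N powr p / (v - u)"
  proof -
    have "(N * (v - u) powr (- (1/p))) powr p = N powr p * (v - u) powr (- 1)"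
      using p uv hardy_boundD(3)[OF f] by (simp add: powr_mult powr_powr del: powr_minus_divide
          powr_minus)
    then show ?thesis using uv by (simp add: powr_minus_divide)
  qed
  ultimately show False using 1 uv by (simp add: field_simps)
qed

text \<open>
  A primitive \<open>F\<close> of \<open>f\<close> need not be bounded, but its horizontal differences \<open>F (z + h) - F z\<close>
  are, uniformly on the half-plane, by \<open>integral_segment_le\<close>. Cauchy's estimate for the
  derivative of this difference on the disc of radius \<open>Im z / 2\<close> gives the claim. This takes the
  place of the mean value property over discs.
\<close>

lemma hardy_bound_shift:
  assumes f: "hardy_bound p f N" and N: "0 < N" and p: "1 \<le> p" and z: "0 < Im z" and h: "0 < h"
  shows "cmod (f (z + of_real h) - f z) \<le> 4 * N * h powr (1 - 1/p) / Im z"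
proof -
  obtain F where F: "\<And>z. 0 < Im z \<Longrightarrow> (F has_field_derivative f z) (at z)"
    using upper_half_plane_primitive[OF hardy_boundD(1)[OF f]] by blast
  define D where "D = (\<lambda>z. F (z + of_real h) - F z)"
  have D': "(D has_field_derivative f (z + of_real h) - f z) (at z)" if "0 < Im z" for z
    unfolding D_def using F[of z] F[of "z + of_real h"] that
    by (auto intro!: derivative_eq_intros DERIV_chain2[of F])
  have Dle: "cmod (D w) \<le> 2 * N * h powr (1 - 1/p)" if w: "0 < Im w" for w
  proof -
    let ?g = "\<lambda>t. f (Complex t (Im w))"
    have "((\<lambda>t. F (Complex t (Im w))) has_vector_derivative ?g t) (at t within {Re w..Re w
        + h})" for t
    proof -
      have "((\<lambda>t. Complex t (Im w)) has_vector_derivative 1) (at t within {Re w..Re w + h})"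
        unfolding Complex_eq by (auto intro!: derivative_eq_intros)
      from field_vector_diff_chain_within[OF this has_field_derivative_at_within[OF F[of
          "Complex t (Im w)"]]]
      show ?thesis using w by (simp add: o_def)
    qed
    then have "(?g has_integral F (Complex (Re w + h) (Im w)) - F (Complex (Re w) (Im w))) {Re
        w..Re w + h}"
      using h by (intro fundamental_theorem_of_calculus) auto
    moreover have "Complex (Re w + h) (Im w) = w + of_real h" "Complex (Re w) (Im w) = w"
      by (auto simp: complex_eq_iff)
    ultimately have "D w = integral {Re w..Re w + h} ?g"
      by (simp add: D_def has_integral_iff)
    also have "cmod \<dots> \<le> integral {Re w..Re w + h} (\<lambda>t. cmod (?g t))"
      by (intro integral_norm_bound_integral integrable_continuous_real continuous_intros
          continuous_on_subset[OF continuous_on_line[OF hardy_boundD(1)[OF f] w] subset_UNIV]) auto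
    also have "\<dots> \<le> 2 * N * (Re w + h - Re w) powr (1 - 1/p)"
      by (rule integral_segment_le[OF f N p w]) (use h in auto)
    finally show ?thesis by simp
  qed
  have cb: "0 < Im w" if "w \<in> cball z (Im z / 2)" for w
  proof -
    have "\<bar>Im (z - w)\<bar> \<le> cmod (z - w)" by (rule abs_Im_le_cmod)
    also have "\<dots> \<le> Im z / 2" using that by (simp add: dist_norm)
    finally show ?thesis using z by (simp add: abs_if split: if_splits)
  qed
  have holo: "D holomorphic_on cball z (Im z / 2)"
    unfolding holomorphic_on_def using D' cb field_differentiable_def
        has_field_derivative_at_within by blast
  have "cmod ((deriv ^^ 1) D z) \<le> fact 1 * (2 * N * h powr (1 - 1/p)) / (Im z / 2) ^ 1"
  proof (rule Cauchy_inequality)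
    show "D holomorphic_on ball z (Im z / 2)" using holo by (rule holomorphic_on_subset) auto
    show "continuous_on (cball z (Im z / 2)) D" using holo
        by (rule holomorphic_on_imp_continuous_on)
    show "cmod (D x) \<le> 2 * N * h powr (1 - 1/p)" if "cmod (z - x) = Im z / 2" for x
      using that by (intro Dle cb) (auto simp: dist_norm)
  qed (use z in auto)
  moreover have "deriv D z = f (z + of_real h) - f z" using D'[OF z] by (rule DERIV_imp_deriv)
  ultimately show ?thesis by simp
qed

text \<open>
  On the segment from \<open>z\<close> to \<open>z + Im z\<close> the function varies by at most a multiple of the
  asserted bound, by \<open>hardy_bound_shift\<close>, and somewhere on it the function is that small.
\<close>

lemma hardy_bound_pointwise:
  assumes f: "hardy_bound p f N" and N: "0 < N" and p: "1 \<le> p" and z: "0 < Im z"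
  shows "cmod (f z) \<le> 5 * N * Im z powr (- (1/p))"
proof -
  let ?y = "Im z"
  have "cmod (f z) \<le> 4 * N * ?y powr (- (1/p)) + N * (Re z + ?y - Re z) powr (- (1/p))"
  proof (rule cmod_le_oscillation[OF f p z])
    fix t assume t: "t \<in> {Re z..Re z + ?y}"
    show "cmod (f z - f (Complex t ?y)) \<le> 4 * N * ?y powr (- (1/p))"
    proof (cases "t = Re z")
      case True
      then show ?thesis using N by simp
    next
      case False
      define h where "h = t - Re z"
      have h: "0 < h" "h \<le> ?y" using t False by (auto simp: h_def)
      have "Complex t ?y = z + of_real h" by (simp add: complex_eq_iff h_def)
      then have "cmod (f z - f (Complex t ?y)) \<le> 4 * N * h powr (1 - 1/p) / ?y"
        using hardy_bound_shift[OF f N p z h(1)] by (simp add: norm_minus_commute)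
      also have "\<dots> \<le> 4 * N * ?y powr (1 - 1/p) / ?y"
        using h p z N by (intro divide_right_mono mult_left_mono powr_mono2) auto
      also have "\<dots> = 4 * N * ?y powr (- (1/p))"
        using z by (simp add: powr_diff powr_minus field_simps)
      finally show ?thesis .
    qed
  qed (use z in auto)
  then show ?thesis by simp
qed

lemma hardy_space_pointwise:
  assumes "f \<in> hardy_space p" "1 \<le> p"
  obtains K where "0 < K" "\<And>z. 0 < Im z \<Longrightarrow> cmod (f z) \<le> K * Im z powr (- (1/p))"
proof -
  have "hardy_bound p f (hardy_norm p f + 1)"
    using assms by (simp add: hardy_bound_iff)
  then show ?thesis
    using that[of "5 * (hardy_norm p f + 1)"] hardy_bound_pointwise[of p f "hardy_norm p f + 1"] 
      assms hardy_norm_nonneg[of p f] by auto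
qed

lemma hardy_norm_pos:
  assumes "f \<in> hardy_space p" "1 \<le> p" "f z \<noteq> 0"
  shows "0 < hardy_norm p f"
proof (rule ccontr)
  assume "\<not> ?thesis"
  then have b: "hardy_bound p f N" if "0 < N" for N
    using assms that by (simp add: hardy_bound_iff)
  have z: "0 < Im z" using hardy_boundD(2)[OF b[of 1], of z] assms by auto
  define c where "c = 5 * Im z powr (- (1/p))"
  have c: "0 < c" using z by (simp add: c_def)
  have "cmod (f z) \<le> N * c" if "0 < N" for N
    using hardy_bound_pointwise[OF b[OF that] that assms(2) z] by (simp add: c_def)
  from this[of "cmod (f z) / (2 * c)"] show False using assms(3) c by (simp add: field_simps)
qed

section \<open>The Euler equation along rays\<close>

lemma dilation_has_vector_derivative:
  "((\<lambda>s. of_real (exp (c * s)) * z) has_vector_derivative of_real c * (of_real (exp (c * s)) * z))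
      (at s within S)"
  for z :: complex and c s :: real
proof -
  have "((\<lambda>s. exp (of_real c * of_real s) * z) has_vector_derivative of_real c * exp (of_real c *
      of_real s) * z)
      (at s within S)"
    by (rule has_vector_derivative_real_field) (auto intro!: derivative_eq_intros)
  then show ?thesis
    by (simp only: of_real_mult[symmetric] exp_of_real mult.assoc) (simp only: of_real_mult
        mult.assoc)
qed

text \<open>
  The equation makes \<open>exp (a s) * d (e\<^sup>s z)\<close> constant in \<open>s\<close>. With the pointwise bound this
  yields \<open>\<bar>d z\<bar> \<le> C exp ((Re a - 1 / p) s)\<close> for all real \<open>s\<close>, and the right-hand side tends to
  \<open>0\<close> at one of the two ends. The case \<open>a = 0\<close> shows that \<open>H\<^sup>p\<close> contains no constant other than
  \<open>0\<close>.
\<close>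

lemma hardy_euler_unique:
  assumes d: "d \<in> hardy_space p" and p: "1 \<le> p" and a: "Re a \<noteq> 1 / p"
    and ode: "\<And>z. 0 < Im z \<Longrightarrow> (d has_field_derivative d' z) (at z)"
        "\<And>z. 0 < Im z \<Longrightarrow> z * d' z + a * d z = 0"
  shows "d = (\<lambda>_. 0)"
proof
  fix z
  obtain K where K: "0 < K" "\<And>z. 0 < Im z \<Longrightarrow> cmod (d z) \<le> K * Im z powr (- (1/p))"
    using hardy_space_pointwise[OF d p] by blast
  show "d z = 0"
  proof (cases "0 < Im z")
    case False
    then show ?thesis using d by (simp add: hardy_space_def)
  next
    case z: True
    \<comment> \<open>\<open>d\<close> along the ray through \<open>z\<close>, divided by its expected homogeneous behaviour\<close>
    define e where "e = (\<lambda>s::real. exp (a * of_real s) * d (of_real (exp s) * z))"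
    have e': "(e has_vector_derivative 0) (at s)" for s
    proof -
      let ?w = "of_real (exp s) * z"
      have w: "0 < Im ?w" using z by simp
      have 1: "((\<lambda>s. of_real (exp s) * z) has_vector_derivative ?w) (at s)"
        using dilation_has_vector_derivative[of 1] by simp
      have 2: "((\<lambda>s. d (of_real (exp s) * z)) has_vector_derivative ?w * d' ?w) (at s)"
        using field_vector_diff_chain_at[OF 1 ode(1)[OF w]] by (simp add: o_def)
      have 3: "((\<lambda>s::real. exp (a * of_real s)) has_vector_derivative a * exp (a * of_real s)) (at
          s)"
        by (rule has_vector_derivative_real_field) (auto intro!: derivative_eq_intros)
      have "(e has_vector_derivative exp (a * of_real s) * (?w * d' ?w)
          + a * exp (a * of_real s) * d ?w) (at s)"
        unfolding e_def using 3 2 by (rule has_vector_derivative_mult)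
      moreover have "exp (a * of_real s) * (?w * d' ?w) + a * exp (a * of_real s) * d ?w
          = exp (a * of_real s) * (?w * d' ?w + a * d ?w)" by (simp add: algebra_simps)
      ultimately show ?thesis by (simp only: ode(2)[OF w] mult_zero_right)
    qed
    have const: "e s = d z" for s
    proof -
      have "\<exists>c. \<forall>x\<in>UNIV. e x = c"
        by (rule has_vector_derivative_zero_constant[OF convex_UNIV e']) blast
      then have "e s = e 0" by (metis UNIV_I)
      also have "e 0 = d z" by (simp add: e_def)
      finally show ?thesis .
    qed
    define l where "l = Re a - 1/p"
    have le: "cmod (d z) \<le> K * Im z powr (- (1/p)) * exp (l * s)" for s
    proof -
      have "cmod (d z) = cmod (exp (a * of_real s)) * cmod (d (of_real (exp s) * z))"
        unfolding const[of s, symmetric] e_def by (rule norm_mult)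
      also have "cmod (exp (a * of_real s)) = exp (Re a * s)"
        by (simp add: norm_exp_eq_Re)
      also have "exp (Re a * s) * cmod (d (of_real (exp s) * z))
          \<le> exp (Re a * s) * (K * (exp s * Im z) powr (- (1/p)))"
        using K(2)[of "of_real (exp s) * z"] z by simp
      also have "(exp s * Im z) powr (- (1/p)) = exp (- (s/p)) * Im z powr (- (1/p))"
        using z by (simp add: powr_mult powr_def[of "exp s"])
      also have "exp (Re a * s) * (K * (exp (- (s/p)) * Im z powr (- (1/p))))
          = K * Im z powr (- (1/p)) * (exp (Re a * s) * exp (- (s/p)))" by simp
      also have "exp (Re a * s) * exp (- (s/p)) = exp (l * s)"
        unfolding exp_add[symmetric] by (simp add: l_def left_diff_distrib)
      finally show ?thesis .
    qed
    have l: "l \<noteq> 0" using a by (simp add: l_def)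
    have lim: "((\<lambda>x. K * Im z powr (- (1/p)) * exp x) \<longlongrightarrow> K * Im z powr (- (1/p)) * 0) at_bot"
      by (intro tendsto_intros exp_at_bot)
    have ev: "\<forall>\<^sub>F x in at_bot. cmod (d z) \<le> K * Im z powr (- (1/p)) * exp x"
    proof (intro always_eventually allI)
      fix x show "cmod (d z) \<le> K * Im z powr (- (1/p)) * exp x"
        using le[of "x / l"] l by simp
    qed
    have "cmod (d z) \<le> K * Im z powr (- (1/p)) * 0"
      by (rule tendsto_lowerbound[OF lim ev]) (rule trivial_limit_at_bot_linorder)
    then show ?thesis by simp
  qed
qed

text \<open>
  The principal branch of \<open>z\<^sup>a\<close>. Unlike \<open>powr\<close> it vanishes nowhere, so that it can be cancelled
  without a side condition on \<open>z\<close>.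
\<close>

definition cpow :: "complex \<Rightarrow> complex \<Rightarrow> complex" where
  "cpow a z = exp (a * Ln z)"

lemma cpow_nonzero [simp]: "cpow a z \<noteq> 0"
  by (simp add: cpow_def)

lemma upper_not_nonpos: "0 < Im z \<Longrightarrow> z \<notin> \<real>\<^sub>\<le>\<^sub>0"
  by (auto simp: complex_nonpos_Reals_iff)

lemma cpow_deriv:
  assumes "0 < Im z"
  shows "(cpow a has_field_derivative a * cpow a z / z) (at z)"
  unfolding cpow_def[abs_def] using upper_not_nonpos[OF assms]
  by (auto intro!: derivative_eq_intros simp: field_simps)

lemma cpow_holomorphic: "cpow a holomorphic_on upper_half_plane"
  unfolding holomorphic_on_open[OF open_upper_half_plane] by (auto intro!: exI cpow_deriv)

lemma cpow_dilation:
  assumes "0 < Im z"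
  shows "cpow a (of_real (exp s) * z) = exp (a * of_real s) * cpow a z"
proof -
  have "Ln (of_real (exp s) * z) = of_real s + Ln z"
    using assms by (subst Ln_times_of_real) (auto simp: Ln_of_real)
  then show ?thesis by (simp add: cpow_def ring_distribs exp_add)
qed

text \<open>
  The growth bound turns into exponential decay along rays. The sign \<open>\<sigma>\<close> selects the direction
  in which \<open>exp (a \<sigma> s) * f\<close> decays: outwards for \<open>\<sigma> = 1\<close>, towards \<open>0\<close> for \<open>\<sigma> = - 1\<close>.
\<close>

lemma ray_integrable:
  fixes a :: complex and \<sigma> K :: real
  assumes f: "f holomorphic_on upper_half_plane"
    and K: "\<And>z. 0 < Im z \<Longrightarrow> cmod (f z) \<le> K * Im z powr (- q)"
    and l: "0 < l" "l = \<sigma> * (q - Re a)" and z: "0 < Im z"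
  defines "g \<equiv> \<lambda>s. exp (a * of_real (\<sigma> * s)) * f (of_real (exp (\<sigma> * s)) * z)"
  shows "continuous_on UNIV g" "\<And>s. cmod (g s) \<le> K * Im z powr (- q) * exp (- (l * s))"
    "set_integrable lborel {0..} g"
proof -
  have "continuous_on UNIV (\<lambda>s. f (of_real (exp (\<sigma> * s)) * z))"
    by (rule continuous_on_compose2[OF holomorphic_on_imp_continuous_on[OF f]])
       (use z in \<open>auto intro!: continuous_intros\<close>)
  then show cont: "continuous_on UNIV g"
    unfolding g_def by (intro continuous_intros)
  show le: "cmod (g s) \<le> K * Im z powr (- q) * exp (- (l * s))" for s
  proof -
    have "cmod (g s) = exp (Re a * (\<sigma> * s)) * cmod (f (of_real (exp (\<sigma> * s)) * z))"
      by (simp add: g_def norm_mult)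
    also have "\<dots> \<le> exp (Re a * (\<sigma> * s)) * (K * (exp (\<sigma> * s) * Im z) powr (- q))"
      using K[of "of_real (exp (\<sigma> * s)) * z"] z by simp
    also have "(exp (\<sigma> * s) * Im z) powr (- q) = exp (- (q * (\<sigma> * s))) * Im z powr (- q)"
      using z by (simp add: powr_mult powr_def[of "exp _"])
    also have "exp (Re a * (\<sigma> * s)) * (K * (exp (- (q * (\<sigma> * s))) * Im z powr (- q)))
        = K * Im z powr (- q) * (exp (Re a * (\<sigma> * s)) * exp (- (q * (\<sigma> * s))))" by simp
    also have "exp (Re a * (\<sigma> * s)) * exp (- (q * (\<sigma> * s))) = exp (- (l * s))"
      unfolding exp_add[symmetric] by (simp add: l algebra_simps)
    finally show ?thesis .
  qed
  have e: "set_integrable lborel {0..} (\<lambda>s. K * Im z powr (- q) * exp (- (l * s)))"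
  proof (rule set_integrable_mult_right)
    have "integrable lborel (exponential_density l)"
      by (rule integrableI_nonneg) (use l nn_integral_erlang_ith_moment[OF l(1), of 0 0] in \<open>auto
          simp: less_top[symmetric]\<close>)
    then have "integrable lborel (\<lambda>s. exponential_density l s / l)" by simp
    moreover have "exponential_density l s / l = indicator {0..} s *\<^sub>R exp (- (l * s))" for s
      using l by (auto simp: exponential_density_def indicator_def mult.commute)
    ultimately show "set_integrable lborel {0..} (\<lambda>s. exp (- (l * s)))"
      by (simp add: set_integrable_def)
  qed
  have [measurable]: "g \<in> borel_measurable borel"
    using cont by (rule borel_measurable_continuous_onI)
  show "set_integrable lborel {0..} g"
    unfolding set_integrable_def
    by (rule Bochner_Integration.integrable_bound[OF e[unfolded set_integrable_def]])
       (use le in \<open>auto simp: indicator_def intro!: AE_I2 order_trans[OF le]\<close>)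
qed

text \<open>
  Variation of constants: \<open>z\<^sup>a g\<close> must be a primitive of \<open>z\<^sup>a f / z\<close>. A given primitive \<open>\<Phi>\<close> has
  a limit along each ray in the direction \<open>\<sigma>\<close>, and this limit \<open>L\<close> is the same for all rays,
  because the primitive changes by a quantity of order \<open>exp (- l s)\<close> along the dilated segment
  between two rays. Subtracting \<open>L\<close> gives a \<open>g\<close> that is holomorphic by construction and is at
  the same time a ray integral.
\<close>

lemma euler_solution_exists:
  fixes a :: complex and \<sigma> K :: real
  assumes f: "f holomorphic_on upper_half_plane"
    and K: "\<And>z. 0 < Im z \<Longrightarrow> cmod (f z) \<le> K * Im z powr (- q)"
    and l: "0 < l" "l = \<sigma> * (q - Re a)" and \<sigma>: "\<bar>\<sigma>\<bar> = 1"
  obtains g where "\<And>z. 0 < Im z \<Longrightarrow> (g has_field_derivative (f z - a * g z) / z) (at z)"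
    "\<And>z. 0 < Im z \<Longrightarrow> cmod (g z) \<le> (LINT s:{0..}|lborel. exp (Re a * (\<sigma> * s)) * cmod (f (of_real
        (exp (\<sigma> * s)) * z)))"
proof -
  define \<phi> where "\<phi> = (\<lambda>z. cpow a z * f z / z)"
  have "\<phi> holomorphic_on upper_half_plane"
    unfolding \<phi>_def by (intro holomorphic_intros cpow_holomorphic f) auto
  then obtain \<Phi> where \<Phi>: "\<And>z. 0 < Im z \<Longrightarrow> (\<Phi> has_field_derivative \<phi> z) (at z)"
    using upper_half_plane_primitive by blast
  define J where "J = (\<lambda>z. LINT s:{0..}|lborel. exp (a * of_real (\<sigma> * s)) * f (of_real (exp (\<sigma> *
      s)) * z))"
  have ray: "((\<lambda>s. \<Phi> (of_real (exp (\<sigma> * s)) * z)) \<longlongrightarrow> \<Phi> z + of_real \<sigma> * cpow a z * J z) at_top"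
    if z: "0 < Im z" for z
  proof -
    let ?g = "\<lambda>s. exp (a * of_real (\<sigma> * s)) * f (of_real (exp (\<sigma> * s)) * z)"
    note R = ray_integrable[OF f K l z]
    have d: "((\<lambda>s. \<Phi> (of_real (exp (\<sigma> * s)) * z)) has_vector_derivative of_real \<sigma> * cpow a z * ?g
        s) (at s within {0..b})" for s b
    proof -
      let ?w = "of_real (exp (\<sigma> * s)) * z"
      have w: "0 < Im ?w" using z by simp
      have 1: "((\<lambda>s. of_real (exp (\<sigma> * s)) * z) has_vector_derivative of_real \<sigma> * ?w) (at s within
          {0..b})"
        by (rule dilation_has_vector_derivative)
      have "\<phi> ?w * ?w = cpow a z * ?g s"
        using w by (auto simp: \<phi>_def cpow_dilation[OF z])
      moreover have "((\<lambda>s. \<Phi> (of_real (exp (\<sigma> * s)) * z)) has_vector_derivative of_real \<sigma> * ?w * \<phi>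
          ?w) (at s within {0..b})"
        using field_vector_diff_chain_within[OF 1 has_field_derivative_at_within[OF \<Phi>[OF w]]]
            by (simp add: o_def)
      moreover have "of_real \<sigma> * ?w * \<phi> ?w = of_real \<sigma> * (\<phi> ?w * ?w)" by simp
      ultimately show ?thesis by (simp only: mult.assoc)
    qed
    have "(LINT s:{0..b}|lborel. of_real \<sigma> * cpow a z * ?g s)
        = \<Phi> (of_real (exp (\<sigma> * b)) * z) - \<Phi> z" if "0 \<le> b" for b
      unfolding set_lebesgue_integral_def
    proof (rule integral_FTC_Icc[where f = "\<lambda>s. of_real \<sigma> * cpow a z * ?g s" and F =
        "\<lambda>s. \<Phi> (of_real (exp (\<sigma> * s)) * z)", OF that d, THEN trans])
      show "continuous_on {0..b} (\<lambda>s. of_real \<sigma> * cpow a z * ?g s)"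
        by (intro continuous_on_mult_left continuous_on_subset[OF R(1) subset_UNIV])
    qed simp
    then have FTC: "\<Phi> z + of_real \<sigma> * cpow a z * (LINT s:{0..b}|lborel. ?g s)
        = \<Phi> (of_real (exp (\<sigma> * b)) * z)" if "0 \<le> b" for b
      using that by simp
    have "((\<lambda>b. \<Phi> z + of_real \<sigma> * cpow a z * (LINT s:{0..b}|lborel. ?g s)) \<longlongrightarrow> \<Phi> z
        + of_real \<sigma> * cpow a z * J z) at_top"
      unfolding J_def by (intro tendsto_intros tendsto_set_lebesgue_integral_at_top R) auto
    then show ?thesis
      by (rule tendsto_cong[THEN iffD1, rotated])
          (use FTC in \<open>auto simp: eventually_at_top_linorder\<close>)
  qed
  define L where "L = \<Phi> \<i> + of_real \<sigma> * cpow a \<i> * J \<i>"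
  have limit: "\<Phi> z + of_real \<sigma> * cpow a z * J z = L" if z: "0 < Im z" for z
  proof -
    let ?S = "closed_segment z \<i>"
    have S: "0 < Im \<zeta>" if "\<zeta> \<in> ?S" for \<zeta>
      using closed_segment_subset[of z upper_half_plane \<i>] convex_upper_half_plane z that by auto
    define m where "m = (\<lambda>\<zeta>. cmod (cpow a \<zeta>) / cmod \<zeta> * (K * Im \<zeta> powr (- q)))"
    have "continuous_on ?S m"
      unfolding m_def
    proof (intro continuous_intros)
      show "continuous_on ?S (cpow a)"
        by (rule continuous_on_subset[OF holomorphic_on_imp_continuous_on[OF cpow_holomorphic]])
            (use S in auto)
    qed (use S in force)+
    then have "bdd_above (m ` ?S)"
      by (intro bounded_imp_bdd_above compact_imp_bounded compact_continuous_image) auto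
    then obtain M where "\<forall>x\<in>m ` ?S. x \<le> M"
      unfolding bdd_above_def ..
    then have M: "m \<zeta> \<le> M" if "\<zeta> \<in> ?S" for \<zeta>
      using that by simp
    have le: "cmod (\<Phi> (of_real (exp (\<sigma> * s)) * z) - \<Phi> (of_real (exp (\<sigma> * s)) * \<i>))
        \<le> M * cmod (z - \<i>) * exp (- (l * s))" for s
    proof -
      let ?r = "exp (\<sigma> * s)"
      have "cmod (\<Phi> (of_real ?r * z) - \<Phi> (of_real ?r * \<i>)) \<le> M * exp (- (l * s)) * cmod (z - \<i>)"
      proof (rule field_differentiable_bound[of ?S "\<lambda>\<zeta>. \<Phi> (of_real ?r * \<zeta>)"
          "\<lambda>\<zeta>. \<phi> (of_real ?r * \<zeta>) * of_real ?r"])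
        fix \<zeta> assume \<zeta>: "\<zeta> \<in> ?S"
        have w: "0 < Im (of_real ?r * \<zeta>)" using S[OF \<zeta>] by simp
        show "((\<lambda>\<zeta>. \<Phi> (of_real ?r * \<zeta>)) has_field_derivative \<phi> (of_real ?r * \<zeta>) * of_real ?r) (at
            \<zeta> within ?S)"
          by (rule DERIV_chain2[where f = \<Phi> and g =
              "\<lambda>\<zeta>. of_real ?r * \<zeta>", OF \<Phi>[OF w]]) (auto intro!: derivative_eq_intros)
        have "cmod (\<phi> (of_real ?r * \<zeta>) * of_real ?r) = exp (Re a * (\<sigma> * s)) * cmod (cpow a \<zeta>) *
            cmod (f (of_real ?r * \<zeta>)) / cmod \<zeta>"
          using S[OF \<zeta>] by (simp add: \<phi>_def cpow_dilation norm_mult norm_divide)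
        also have "\<dots> = cmod (cpow a \<zeta>) / cmod \<zeta> * cmod (exp (a * of_real (\<sigma> * s)) * f (of_real ?r
            * \<zeta>))"
          by (simp add: norm_mult)
        also have "\<dots> \<le> cmod (cpow a \<zeta>) / cmod \<zeta> * (K * Im \<zeta> powr (- q) * exp (- (l * s)))"
          by (intro mult_left_mono ray_integrable(2)[OF f K l S[OF \<zeta>]]) auto
        also have "\<dots> = m \<zeta> * exp (- (l * s))" by (simp add: m_def)
        also have "\<dots> \<le> M * exp (- (l * s))" by (intro mult_right_mono M \<zeta>) auto
        finally show "cmod (\<phi> (of_real ?r * \<zeta>) * of_real ?r) \<le> M * exp (- (l * s))" .
      qed auto
      then show ?thesis by (simp add: algebra_simps)
    qed
    have "filterlim (\<lambda>s. - (l * s)) at_bot at_top"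
      using l(1) by (intro filterlim_uminus_at_bot[THEN iffD2]) (simp add: filterlim_ident
          filterlim_tendsto_pos_mult_at_top[OF tendsto_const])
    then have "((\<lambda>s. M * cmod (z - \<i>) * exp (- (l * s))) \<longlongrightarrow> 0) at_top"
      by (intro tendsto_mult_right_zero filterlim_compose[OF exp_at_bot])
    then have A: "((\<lambda>s. \<Phi> (of_real (exp (\<sigma> * s)) * z) - \<Phi> (of_real (exp (\<sigma> * s)) * \<i>)) \<longlongrightarrow> 0) at_top"
      by (rule Lim_null_comparison[rotated]) (use le in auto)
    have B: "((\<lambda>s. \<Phi> (of_real (exp (\<sigma> * s)) * z) - \<Phi> (of_real (exp (\<sigma> * s)) * \<i>)) \<longlongrightarrow> (\<Phi> z
        + of_real \<sigma> * cpow a z * J z) - L) at_top"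
      unfolding L_def using z by (intro tendsto_diff ray) auto
    have "(\<Phi> z + of_real \<sigma> * cpow a z * J z) - L = 0"
      by (rule tendsto_unique[OF trivial_limit_at_top_linorder B A])
    then show ?thesis by simp
  qed
  define g where "g = (\<lambda>z. (\<Phi> z - L) / cpow a z)"
  show ?thesis
  proof
    fix z :: complex assume z: "0 < Im z"
    show "(g has_field_derivative (f z - a * g z) / z) (at z)"
    proof -
      have "(g has_field_derivative (\<phi> z * cpow a z - (\<Phi> z - L) * (a * cpow a z / z)) / (cpow a z
          * cpow a z)) (at z)"
        unfolding g_def using DERIV_divide[OF DERIV_diff[OF \<Phi>[OF z] DERIV_const[of L]]
            cpow_deriv[OF z] cpow_nonzero] by simp
      moreover have "(\<phi> z * cpow a z - (\<Phi> z - L) * (a * cpow a z / z)) / (cpow a z * cpow a z)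
          = (f z - a * g z) / z"
      proof -
        define c where "c = cpow a z"
        have c: "c \<noteq> 0" "z \<noteq> 0" "\<Phi> z - L = g z * c" using z by (auto simp: c_def g_def)
        have "(c * f z / z * c - g z * c * (a * c / z)) / (c * c) = (f z - a * g z) / z"
          using c(1,2) by (simp add: divide_simps) (simp add: algebra_simps)
        then show ?thesis unfolding c(3) \<phi>_def c_def[symmetric] .
      qed
      ultimately show ?thesis by simp
    qed
    have "g z = - of_real \<sigma> * J z"
      unfolding g_def limit[OF z, symmetric] by (simp add: field_simps)
    then have "cmod (g z) = cmod (J z)"
      using \<sigma> by (simp add: norm_mult)
    also have "\<dots> \<le> (LINT s:{0..}|lborel. cmod (exp (a * of_real (\<sigma> * s)) * f (of_real (exp (\<sigma> *
        s)) * z)))"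
      unfolding J_def by (rule set_integral_norm_bound) (rule ray_integrable[OF f K l z])
    finally show "cmod (g z) \<le> (LINT s:{0..}|lborel. exp (Re a * (\<sigma> * s)) * cmod (f (of_real (exp
        (\<sigma> * s)) * z)))"
      by (simp add: norm_mult)
  qed
qed

section \<open>The norm of the solution\<close>

lemma powr_above_tangent:
  fixes m p x :: real
  assumes "1 \<le> p" "0 < m" "0 \<le> x"
  shows "m powr p + p * m powr (p - 1) * (x - m) \<le> x powr p"
proof (cases "x = 0")
  case True
  have "m powr p = m powr (p - 1) * m" using assms by (simp add: powr_diff)
  then have "m powr p + p * m powr (p - 1) * (0 - m) = (1 - p) * m powr p"
      by (simp add: algebra_simps)
  also have "\<dots> \<le> 0" using assms by (simp add: mult_nonpos_nonneg)
  finally show ?thesis using True by simp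
next
  case False
  have "p * m powr (p - 1) * (x - m) \<le> x powr p - m powr p"
  proof (rule convex_on_imp_above_tangent[where A = "{0<..}"])
    show "((\<lambda>x. x powr p) has_real_derivative p * m powr (p - 1)) (at m within {0<..})"
      using assms by (auto intro!: derivative_eq_intros simp: powr_diff)
  qed (use assms False in \<open>auto intro!: powr_convex convex_connected simp: interior_open\<close>)
  then show ?thesis by simp
qed

text \<open>
  Jensen's inequality for \<open>x powr p\<close> on the closed half-line, by integrating the tangent at the
  mean.
\<close>

lemma (in prob_space) expectation_powr_le:
  fixes X :: "'a \<Rightarrow> real"
  assumes p: "1 \<le> p" and X: "\<And>x. 0 \<le> X x" "integrable M X" "integrable M (\<lambda>x. X x powr p)"
  shows "expectation X powr p \<le> expectation (\<lambda>x. X x powr p)"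
proof (cases "expectation X = 0")
  case True
  then show ?thesis by (simp add: Bochner_Integration.integral_nonneg)
next
  case False
  define m where "m = expectation X"
  have m: "0 < m" using False Bochner_Integration.integral_nonneg[of M X] X(1) unfolding m_def
      by fastforce
  have "expectation (\<lambda>x. m powr p + p * m powr (p - 1) * (X x - m)) \<le> expectation (\<lambda>x. X x powr p)"
    by (intro integral_mono powr_above_tangent p m X Bochner_Integration.integrable_add
        integrable_mult_right Bochner_Integration.integrable_diff) auto
  also have "expectation (\<lambda>x. m powr p + p * m powr (p - 1) * (X x - m)) = m powr p"
    using X(2) by (simp add: m_def prob_space)
  finally show ?thesis by (simp add: m_def)
qed

text \<open>
  Minkowski's inequality for the ray integral. The weight \<open>exp (\<alpha> \<sigma> s)\<close> is split as the density
  of the exponential distribution \<open>\<mu>\<close> with parameter \<open>l\<close>, divided by \<open>l\<close>, times \<open>exp (\<sigma> s / p)\<close>.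
  The last factor is what makes dilation by \<open>exp (\<sigma> s)\<close> norm preserving. Jensen's inequality for
  \<open>\<mu>\<close> and Tonelli's theorem then bound the line integrals of \<open>g\<close> by those of \<open>f\<close>, with the
  factor \<open>l powr (- p)\<close>.
\<close>

lemma hardy_euler_bound:
  fixes \<alpha> \<sigma> N p :: real
  assumes f: "hardy_bound p f N" and p: "1 \<le> p" and l: "0 < l" "l = \<sigma> * (1/p - \<alpha>)"
    and g: "g holomorphic_on upper_half_plane" "\<And>z. \<not> 0 < Im z \<Longrightarrow> g z = 0"
    and gle: "\<And>z. 0 < Im z \<Longrightarrow> cmod (g z) \<le> (LINT s:{0..}|lborel. exp (\<alpha> * (\<sigma> * s)) * cmod (f
        (of_real (exp (\<sigma> * s)) * z)))"
  shows "hardy_bound p g (N / l)"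
proof -
  note fh = hardy_boundD(1)[OF f] and N = hardy_boundD(3)[OF f]
  have "f \<in> hardy_space p"
    using f p by (simp add: hardy_bound_iff)
  then obtain K where K: "0 < K" "\<And>z. 0 < Im z \<Longrightarrow> cmod (f z) \<le> K * Im z powr (- (1/p))"
    using hardy_space_pointwise[OF _ p] by blast
  define \<mu> where "\<mu> = density lborel (exponential_density l)"
  interpret \<mu>: prob_space \<mu>
    unfolding \<mu>_def using l(1) by (rule prob_space_exponential_density)
  interpret pair_sigma_finite lborel \<mu> by standard
  have sets_\<mu> [measurable_cong]: "sets \<mu> = sets borel" by (simp add: \<mu>_def)
  define X where "X = (\<lambda>z s. exp (\<sigma> * s / p) * cmod (f (of_real (exp (\<sigma> * s)) * z)))"
  have Xpos: "0 \<le> X z s" for z s by (simp add: X_def)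
  have Xcont: "continuous_on UNIV (\<lambda>(x, s). X (Complex x y) s)" if "0 < y" for y
  proof -
    have "continuous_on UNIV (\<lambda>(x, s). f (of_real (exp (\<sigma> * s)) * Complex x y))"
      unfolding case_prod_beta
      by (rule continuous_on_compose2[OF holomorphic_on_imp_continuous_on[OF fh]])
         (use that in \<open>auto intro!: continuous_intros simp: Complex_eq\<close>)
    then show ?thesis
      using p unfolding X_def case_prod_beta by (intro continuous_intros) auto
  qed
  have Xmeas2 [measurable]: "(\<lambda>(x, s). X (Complex x y) s) \<in> borel_measurable (lborel \<Otimes>\<^sub>M \<mu>)" if
      "0 < y" for y
  proof -
    have "(\<lambda>(x, s). X (Complex x y) s) \<in> borel_measurable borel"
      using Xcont[OF that] by (rule borel_measurable_continuous_onI)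
    moreover have "sets (lborel \<Otimes>\<^sub>M \<mu>) = sets (borel :: (real \<times> real) measure)"
      by (simp add: borel_prod[symmetric] sets_\<mu> cong: sets_pair_measure_cong)
    ultimately show ?thesis by (simp cong: measurable_cong_sets)
  qed
  have Xle: "X z s \<le> K * Im z powr (- (1/p))" if "0 < Im z" for z s
  proof -
    have "X z s \<le> exp (\<sigma> * s / p) * (K * (exp (\<sigma> * s) * Im z) powr (- (1/p)))"
      unfolding X_def using K(2)[of "of_real (exp (\<sigma> * s)) * z"] that by (intro mult_left_mono) auto
    also have "(exp (\<sigma> * s) * Im z) powr (- (1/p)) = exp (- (\<sigma> * s / p)) * Im z powr (- (1/p))"
      using that by (simp add: powr_mult powr_def[of "exp _"])
    also have "exp (\<sigma> * s / p) * (K * (exp (- (\<sigma> * s / p)) * Im z powr (- (1/p))))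
        = K * Im z powr (- (1/p)) * (exp (\<sigma> * s / p) * exp (- (\<sigma> * s / p)))" by simp
    also have "exp (\<sigma> * s / p) * exp (- (\<sigma> * s / p)) = 1"
      unfolding exp_add[symmetric] by simp
    finally show ?thesis by simp
  qed
  have Xmeas: "X z \<in> borel_measurable \<mu>" if "0 < Im z" for z
  proof -
    have "(\<lambda>s. (case (Re z, s) of (x, s) \<Rightarrow> X (Complex x (Im z)) s)) \<in> borel_measurable \<mu>"
      by (rule measurable_compose[OF measurable_Pair1' Xmeas2[OF that]]) simp
    then show ?thesis by simp
  qed
  have Xint: "integrable \<mu> (X z)" and Xpint: "integrable \<mu> (\<lambda>s. X z s powr p)" if z:
      "0 < Im z" for z
  proof -
    note [measurable] = Xmeas[OF z]
    show "integrable \<mu> (X z)"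
      by (rule \<mu>.integrable_const_bound[where B = "K * Im z powr (- (1/p))"])
         (use Xle[OF z] Xpos in \<open>auto simp: abs_of_nonneg\<close>)
    show "integrable \<mu> (\<lambda>s. X z s powr p)"
      by (rule \<mu>.integrable_const_bound[where B = "(K * Im z powr (- (1/p))) powr p"])
         (use Xle[OF z] Xpos p in \<open>auto intro!: powr_mono2\<close>)
  qed
  have gX: "cmod (g z) powr p \<le> (1/l) powr p * (LINT s|\<mu>. X z s powr p)" if z: "0 < Im z" for z
  proof -
    have "(LINT s|\<mu>. X z s) = (LINT s|lborel. exponential_density l s *\<^sub>R X z s)"
      unfolding \<mu>_def
      by (rule integral_density) (use Xmeas[OF z] l in \<open>auto simp: \<mu>_def\<close>)
    also have "\<dots> = (LINT s|lborel. l * (indicator {0..} s *\<^sub>R (exp (\<alpha> * (\<sigma> * s)) * cmod (f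
        (of_real (exp (\<sigma> * s)) * z)))))"
    proof (rule Bochner_Integration.integral_cong[OF refl])
      fix s :: real
      have "exp (- s * l) * exp (\<sigma> * s / p) = exp (\<alpha> * (\<sigma> * s))"
        unfolding exp_add[symmetric] l(2) by (simp add: algebra_simps)
      then show "exponential_density l s *\<^sub>R X z s
          = l * (indicator {0..} s *\<^sub>R (exp (\<alpha> * (\<sigma> * s)) * cmod (f (of_real (exp (\<sigma> * s)) * z))))"
        by (simp add: exponential_density_def X_def indicator_def)
    qed
    also have "\<dots> = l * (LINT s:{0..}|lborel. exp (\<alpha> * (\<sigma> * s)) * cmod (f (of_real (exp (\<sigma> * s)) *
        z)))"
      by (simp add: set_lebesgue_integral_def)
    finally have "cmod (g z) \<le> (1/l) * (LINT s|\<mu>. X z s)"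
      using gle[OF z] l(1) by simp
    then have "cmod (g z) powr p \<le> ((1/l) * (LINT s|\<mu>. X z s)) powr p"
      using p by (intro powr_mono2) auto
    also have "\<dots> = (1/l) powr p * (LINT s|\<mu>. X z s) powr p"
      by (rule powr_mult)
    also have "\<dots> \<le> (1/l) powr p * (LINT s|\<mu>. X z s powr p)"
      using \<mu>.expectation_powr_le[OF p Xpos Xint[OF z] Xpint[OF z]] by (simp add: mult_left_mono)
    finally show ?thesis .
  qed
  \<comment> \<open>the dilate normalized by \<open>exp (\<sigma> s / p)\<close> has on each line the \<open>p\<close>-th power integral of \<open>f\<close> on the dilated line\<close>
  have nn_line: "(\<integral>\<^sup>+x. X (Complex x y) s powr p \<partial>lborel) \<le> N powr p" if y: "0 < y" for y s
  proof -
    let ?r = "exp (\<sigma> * s)"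
    define F where "F = (\<lambda>x. ennreal (cmod (f (Complex x (?r * y))) powr p))"
    have [measurable]: "F \<in> borel_measurable borel"
      unfolding F_def using measurable_line_powr[OF fh, of "?r * y" p] y by simp
    have "exp (\<sigma> * s / p) powr p = ?r"
      using p by (simp add: powr_def)
    moreover have "of_real ?r * Complex x y = Complex (0 + ?r * x) (?r * y)" for x
      by (simp add: complex_eq_iff)
    ultimately have "ennreal (X (Complex x y) s powr p) = ennreal ?r * F (0 + ?r * x)" for x
      unfolding X_def F_def by (simp add: powr_mult ennreal_mult del: add_0)
    then have "(\<integral>\<^sup>+x. X (Complex x y) s powr p \<partial>lborel) = ennreal \<bar>?r\<bar> * (\<integral>\<^sup>+x. F (0
        + ?r * x) \<partial>lborel)"
      by (simp add: nn_integral_cmult del: add_0)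
    also have "\<dots> = (\<integral>\<^sup>+x. F x \<partial>lborel)"
      by (rule nn_integral_real_affine[symmetric]) auto
    also have "\<dots> = ennreal (LINT x|lborel. cmod (f (Complex x (?r * y))) powr p)"
      unfolding F_def using hardy_boundD(4)[OF f, of
          "?r * y"] y by (intro nn_integral_eq_integral) auto
    also have "\<dots> \<le> N powr p"
      using hardy_boundD(5)[OF f, of "?r * y"] y by (intro ennreal_leI) auto
    finally show ?thesis .
  qed
  show ?thesis
  proof (rule hardy_bound_if_le_integrable[OF g, where u =
      "\<lambda>y x. (1/l) powr p * (LINT s|\<mu>. X (Complex x y) s powr p)"])
    fix y :: real assume "0 < y"
    then show "AE x in lborel. cmod (g (Complex x y)) powr p
        \<le> (1/l) powr p * (LINT s|\<mu>. X (Complex x y) s powr p)"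
      by (intro AE_I2 gX) simp
  next
    fix y :: real assume y: "0 < y"
    note [measurable] = Xmeas2[OF y]
    have m: "(\<lambda>x. LINT s|\<mu>. X (Complex x y) s powr p) \<in> borel_measurable lborel"
      by measurable
    have "(\<integral>\<^sup>+x. ennreal (LINT s|\<mu>. X (Complex x y) s powr p) \<partial>lborel)
        = (\<integral>\<^sup>+x. \<integral>\<^sup>+s. X (Complex x y) s powr p \<partial>\<mu> \<partial>lborel)"
      using Xpint y by (intro nn_integral_cong nn_integral_eq_integral[symmetric]) auto
    also have "\<dots> = (\<integral>\<^sup>+s. \<integral>\<^sup>+x. X (Complex x y) s powr p \<partial>lborel \<partial>\<mu>)"
      by (rule Fubini'[symmetric]) measurable
    also have "\<dots> \<le> (\<integral>\<^sup>+s. N powr p \<partial>\<mu>)"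
      by (intro nn_integral_mono nn_line y)
    also have "\<dots> = N powr p"
      by (simp add: \<mu>.emeasure_space_1)
    finally have le: "(\<integral>\<^sup>+x. ennreal (LINT s|\<mu>. X (Complex x y) s powr p) \<partial>lborel) \<le> N powr p" .
    have i: "integrable lborel (\<lambda>x. LINT s|\<mu>. X (Complex x y) s powr p)"
      by (rule integrableI_nonneg[OF m])
         (use le in \<open>auto intro!: AE_I2 Bochner_Integration.integral_nonneg order.strict_trans1[OF
             le]\<close>)
    then show "integrable lborel (\<lambda>x. (1/l) powr p * (LINT s|\<mu>. X (Complex x y) s powr p))"
      by (rule integrable_mult_right)
    have "ennreal (LINT x|lborel. LINT s|\<mu>. X (Complex x y) s powr p) \<le> N powr p"
      using le nn_integral_eq_integral[OF i] by (simp add: Bochner_Integration.integral_nonneg)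
    then have "(LINT x|lborel. LINT s|\<mu>. X (Complex x y) s powr p) \<le> N powr p"
      by (simp add: ennreal_le_iff)
    then have "(1/l) powr p * (LINT x|lborel. LINT s|\<mu>. X (Complex x y) s powr p)
        \<le> (1/l) powr p * N powr p"
      by (intro mult_left_mono) auto
    also have "\<dots> = (N / l) powr p"
      using N l(1) by (simp add: powr_mult[symmetric])
    finally show "(LINT x|lborel. (1/l) powr p * (LINT s|\<mu>. X (Complex x y) s powr p))
        \<le> (N / l) powr p"
      by simp
  qed (use N l in auto)
qed

lemma hardy_euler_exists:
  assumes f: "hardy_bound p f N" and p: "1 \<le> p" and a: "Re a \<noteq> 1/p"
  obtains g where "hardy_bound p g (N / \<bar>1/p - Re a\<bar>)"
    "\<And>z. 0 < Im z \<Longrightarrow> (g has_field_derivative (f z - a * g z) / z) (at z)"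
proof -
  define \<sigma> where "\<sigma> = sgn (1/p - Re a)"
  define l where "l = \<sigma> * (1/p - Re a)"
  have \<sigma>: "\<bar>\<sigma>\<bar> = 1" using a by (simp add: \<sigma>_def abs_sgn_eq)
  have labs: "l = \<bar>1/p - Re a\<bar>" by (simp add: l_def \<sigma>_def sgn_if)
  have l: "0 < l" using a by (simp add: labs)
  have "f \<in> hardy_space p"
    using f p by (simp add: hardy_bound_iff)
  then obtain K where K: "0 < K" "\<And>z. 0 < Im z \<Longrightarrow> cmod (f z) \<le> K * Im z powr (- (1/p))"
    using hardy_space_pointwise[OF _ p] by blast
  obtain g0 where g0: "\<And>z. 0 < Im z \<Longrightarrow> (g0 has_field_derivative (f z - a * g0 z) / z) (at z)"
    "\<And>z. 0 < Im z \<Longrightarrow> cmod (g0 z) \<le> (LINT s:{0..}|lborel. exp (Re a * (\<sigma> * s)) * cmod (f (of_real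
        (exp (\<sigma> * s)) * z)))"
    using euler_solution_exists[OF hardy_boundD(1)[OF f] K(2) l l_def \<sigma>] by blast
  define g where "g = (\<lambda>z. if 0 < Im z then g0 z else 0)"
  have g': "(g has_field_derivative (f z - a * g z) / z) (at z)" if z: "0 < Im z" for z
  proof -
    have "(g has_field_derivative (f z - a * g0 z) / z) (at z)"
      by (rule has_field_derivative_transform_within_open[OF g0(1)[OF z] open_upper_half_plane])
         (use z in \<open>auto simp: g_def\<close>)
    then show ?thesis using z by (simp add: g_def)
  qed
  have "hardy_bound p g (N / l)"
  proof (rule hardy_euler_bound[OF f p l l_def])
    show "g holomorphic_on upper_half_plane"
      unfolding holomorphic_on_open[OF open_upper_half_plane] by (auto intro!: exI g')
  qed (use g0(2) in \<open>auto simp: g_def\<close>)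
  with that g' show ?thesis by (simp add: labs)
qed

section \<open>The operator as a resolvent\<close>

text \<open>
  The kernel \<open>1 / \<zeta>\<close> is at most \<open>1 / r\<close> in modulus on a segment whose real parts stay at
  distance \<open>r\<close> from \<open>0\<close>, however close the segment is to the real axis.
\<close>

lemma hardy_primitive_increment:
  assumes f: "hardy_bound p f M" and M: "0 < M" and p: "1 \<le> p" and y: "0 < y"
    and g: "\<And>z. 0 < Im z \<Longrightarrow> (g has_field_derivative f z / z) (at z)"
    and uv: "u < v" and r: "0 < r" "\<And>t. t \<in> {u..v} \<Longrightarrow> r \<le> \<bar>t\<bar>"
  shows "cmod (g (Complex v y) - g (Complex u y)) \<le> 2 * M * (v - u) powr (1 - 1/p) / r"
proof -
  let ?f = "\<lambda>t. f (Complex t y)" and ?h = "\<lambda>t. f (Complex t y) / Complex t y"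
  have "((\<lambda>t. g (Complex t y)) has_vector_derivative ?h t) (at t within {u..v})" for t
  proof -
    have "((\<lambda>t. Complex t y) has_vector_derivative 1) (at t within {u..v})"
      unfolding Complex_eq by (auto intro!: derivative_eq_intros)
    from field_vector_diff_chain_within[OF this has_field_derivative_at_within[OF g[of
        "Complex t y"]]]
    show ?thesis using y by (simp add: o_def)
  qed
  then have hI: "(?h has_integral g (Complex v y) - g (Complex u y)) {u..v}"
    using uv by (intro fundamental_theorem_of_calculus) auto
  have int: "(\<lambda>t. cmod (?f t)) integrable_on {u..v}"
    by (intro integrable_continuous_real continuous_intros
        continuous_on_subset[OF continuous_on_line[OF hardy_boundD(1)[OF f] y] subset_UNIV])
  have "cmod (g (Complex v y) - g (Complex u y)) = cmod (integral {u..v} ?h)"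
    using hI by (simp add: has_integral_iff)
  also have "\<dots> \<le> integral {u..v} (\<lambda>t. cmod (?f t) / r)"
  proof (rule integral_norm_bound_integral)
    show "?h integrable_on {u..v}" using hI by (simp add: has_integral_iff)
    show "(\<lambda>t. cmod (?f t) / r) integrable_on {u..v}"
      unfolding divide_inverse by (rule integrable_on_mult_left[OF int])
    fix t assume t: "t \<in> {u..v}"
    have "r \<le> cmod (Complex t y)"
      using r(2)[OF t] abs_Re_le_cmod[of "Complex t y"] by simp
    then show "cmod (?h t) \<le> cmod (?f t) / r"
      using r(1) by (simp add: norm_divide frac_le)
  qed
  also have "\<dots> = integral {u..v} (\<lambda>t. cmod (?f t)) / r" by simp
  also have "\<dots> \<le> 2 * M * (v - u) powr (1 - 1/p) / r"
    using integral_segment_le[OF f M p y uv] r(1) by (simp add: divide_right_mono)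
  finally show ?thesis .
qed

text \<open>
  This is what makes the limit at infinity unrestricted. In the sector \<open>Im z \<ge> \<bar>Re z\<bar>\<close> the
  pointwise bound suffices. Near the real axis it degenerates; there \<open>z\<close> is compared with the
  points of the horizontal segment of length \<open>\<bar>Re z\<bar>\<close> that leads away from the imaginary axis.
\<close>

lemma hardy_primitive_decay:
  assumes f: "hardy_bound p f M" and M: "0 < M" and g: "hardy_bound p g N" and N: "0 < N" and p:
      "1 \<le> p"
    and g': "\<And>z. 0 < Im z \<Longrightarrow> (g has_field_derivative f z / z) (at z)" and z: "0 < Im z"
  shows "cmod (g z) \<le> (2 * M + 5 * N) * (cmod z / 2) powr (- (1/p))"
proof (cases "Im z < \<bar>Re z\<bar>")
  case False
  have "cmod z \<le> \<bar>Re z\<bar> + \<bar>Im z\<bar>" by (rule cmod_le)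
  then have le: "cmod z / 2 \<le> Im z" using False z by simp
  have "cmod (g z) \<le> 5 * N * Im z powr (- (1/p))"
    by (rule hardy_bound_pointwise[OF g N p z])
  also have "\<dots> \<le> (2 * M + 5 * N) * (cmod z / 2) powr (- (1/p))"
    using p z le M N by (intro mult_mono powr_mono2') auto
  finally show ?thesis .
next
  case True
  define h where "h = \<bar>Re z\<bar>"
  have h: "0 < h" using True z by (simp add: h_def)
  have "cmod z \<le> \<bar>Re z\<bar> + \<bar>Im z\<bar>" by (rule cmod_le)
  then have le: "cmod z / 2 \<le> h" using True z by (simp add: h_def)
  define u where "u = (if 0 < Re z then Re z else Re z - h)"
  have E: "cmod (g z - g (Complex t (Im z))) \<le> 2 * M * h powr (- (1/p))" if t:
      "t \<in> {u..u + h}" for t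
  proof (cases "t = Re z")
    case True
    then show ?thesis using M by simp
  next
    case False
    define \<alpha> \<beta> where "\<alpha> = min t (Re z)" and "\<beta> = max t (Re z)"
    have \<alpha>\<beta>: "\<alpha> < \<beta>" "\<beta> - \<alpha> \<le> h"
      using False t by (auto simp: \<alpha>_def \<beta>_def u_def min_def max_def split: if_splits)
    have far: "h \<le> \<bar>x\<bar>" if "x \<in> {\<alpha>..\<beta>}" for x
      using that t h by (auto simp: \<alpha>_def \<beta>_def u_def h_def min_def max_def abs_if split: if_splits)
    have "cmod (g (Complex \<beta> (Im z)) - g (Complex \<alpha> (Im z))) \<le> 2 * M * (\<beta> - \<alpha>) powr (1 - 1/p) / h"
      by (rule hardy_primitive_increment[OF f M p z g' \<alpha>\<beta>(1) h far])
    also have "\<dots> \<le> 2 * M * h powr (1 - 1/p) / h"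
      using \<alpha>\<beta> h M p by (intro divide_right_mono mult_left_mono powr_mono2) auto
    also have "\<dots> = 2 * M * h powr (- (1/p))"
      using h by (simp add: powr_diff powr_minus field_simps)
    finally have *: "cmod (g (Complex \<beta> (Im z)) - g (Complex \<alpha> (Im z)))
        \<le> 2 * M * h powr (- (1/p))" .
    have "Complex (Re z) (Im z) = z" by simp
    then show ?thesis
      using * False by (cases "t < Re z") (auto simp: \<alpha>_def \<beta>_def min_def max_def
          norm_minus_commute)
  qed
  have "cmod (g z) \<le> 2 * M * h powr (- (1/p)) + N * (u + h - u) powr (- (1/p))"
    by (rule cmod_le_oscillation[OF g p z _ E]) (use h in auto)
  also have "\<dots> = (2 * M + N) * h powr (- (1/p))" by (simp add: algebra_simps)
  also have "\<dots> \<le> (2 * M + 5 * N) * (cmod z / 2) powr (- (1/p))"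
    using p z le M N by (intro mult_mono powr_mono2') auto
  finally show ?thesis .
qed

text \<open>
  Up to sign the resolvent of the Euler operator \<open>f \<mapsto> z f'\<close> at \<open>- a\<close>, well defined by
  \<open>euler_resolvent_unique\<close>.
\<close>

definition euler_resolvent :: "real \<Rightarrow> complex \<Rightarrow> (complex \<Rightarrow> complex) \<Rightarrow> complex \<Rightarrow> complex" where
  "euler_resolvent p a f = (SOME g. g \<in> hardy_space p \<and> hardy_norm p g
      \<le> hardy_norm p f / \<bar>1/p - Re a\<bar>
    \<and> (\<forall>z. 0 < Im z \<longrightarrow> (g has_field_derivative (f z - a * g z) / z) (at z)))"

lemma euler_resolvent:
  assumes f: "f \<in> hardy_space p" and p: "1 \<le> p" and a: "Re a \<noteq> 1/p"
  shows "euler_resolvent p a f \<in> hardy_space p"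
    "hardy_norm p (euler_resolvent p a f) \<le> hardy_norm p f / \<bar>1/p - Re a\<bar>"
    "0 < Im z \<Longrightarrow> (euler_resolvent p a f has_field_derivative (f z - a * euler_resolvent p a f z) /
        z) (at z)"
proof -
  have f': "hardy_bound p f (hardy_norm p f)" using f p by (simp add: hardy_bound_iff)
  obtain g where g: "hardy_bound p g (hardy_norm p f / \<bar>1/p - Re a\<bar>)"
    "\<And>z. 0 < Im z \<Longrightarrow> (g has_field_derivative (f z - a * g z) / z) (at z)"
    using hardy_euler_exists[OF f' p a] by blast
  have "g \<in> hardy_space p" "hardy_norm p g \<le> hardy_norm p f / \<bar>1/p - Re a\<bar>"
    using g(1) p by (auto simp: hardy_bound_iff)
  with g(2) have "\<exists>g. g \<in> hardy_space p \<and> hardy_norm p g \<le> hardy_norm p f / \<bar>1/p - Re a\<bar>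
    \<and> (\<forall>z. 0 < Im z \<longrightarrow> (g has_field_derivative (f z - a * g z) / z) (at z))" by blast
  from someI_ex[OF this, folded euler_resolvent_def]
  show "euler_resolvent p a f \<in> hardy_space p"
    "hardy_norm p (euler_resolvent p a f) \<le> hardy_norm p f / \<bar>1/p - Re a\<bar>"
    "0 < Im z \<Longrightarrow> (euler_resolvent p a f has_field_derivative (f z - a * euler_resolvent p a f z) /
        z) (at z)"
    by auto
qed

lemma hardy_space_add:
  assumes "f \<in> hardy_space p" "g \<in> hardy_space p" "1 \<le> p"
  shows "(\<lambda>z. f z + g z) \<in> hardy_space p"
    "hardy_norm p (\<lambda>z. f z + g z) \<le> 4 * max (hardy_norm p f) (hardy_norm p g)"
  using hardy_bound_add[of p f "hardy_norm p f" g "hardy_norm p g"] assms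
  by (auto simp: hardy_bound_iff)

lemma hardy_space_mult:
  assumes "f \<in> hardy_space p" "1 \<le> p"
  shows "(\<lambda>z. c * f z) \<in> hardy_space p" "hardy_norm p (\<lambda>z. c * f z) \<le> cmod c * hardy_norm p f"
proof -
  have f: "hardy_bound p f (hardy_norm p f)" using assms by (simp add: hardy_bound_iff)
  have "hardy_bound p (\<lambda>z. c * f z) (cmod c * hardy_norm p f)"
    by (rule hardy_bound_dominated[OF f])
       (use hardy_boundD[OF f] assms in \<open>auto intro!: holomorphic_intros simp: norm_mult\<close>)
  then show "(\<lambda>z. c * f z) \<in> hardy_space p" "hardy_norm p (\<lambda>z. c * f z) \<le> cmod c * hardy_norm p f"
    using assms by (auto simp: hardy_bound_iff)
qed

lemma hardy_space_diff:
  assumes "f \<in> hardy_space p" "g \<in> hardy_space p" "1 \<le> p"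
  shows "(\<lambda>z. f z - g z) \<in> hardy_space p"
  using hardy_space_add(1)[OF assms(1) hardy_space_mult(1)[OF assms(2), of "- 1"]] assms by simp

lemma euler_resolvent_unique:
  assumes f: "f \<in> hardy_space p" and g: "g \<in> hardy_space p" and p: "1 \<le> p" and a: "Re a \<noteq> 1/p"
    and g': "\<And>z. 0 < Im z \<Longrightarrow> (g has_field_derivative (f z - a * g z) / z) (at z)"
  shows "euler_resolvent p a f = g"
proof -
  define d where "d = (\<lambda>z. euler_resolvent p a f z - g z)"
  have "d = (\<lambda>_. 0)"
  proof (rule hardy_euler_unique[OF _ p a])
    show "d \<in> hardy_space p"
      unfolding d_def by (intro hardy_space_diff euler_resolvent f g p a)
    fix z :: complex assume z: "0 < Im z"
    show "(d has_field_derivative (f z - a * euler_resolvent p a f z) / z - (f z - a * g z) / z)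
        (at z)"
      unfolding d_def by (intro DERIV_diff euler_resolvent(3)[OF f p a z] g'[OF z])
    show "z * ((f z - a * euler_resolvent p a f z) / z - (f z - a * g z) / z) + a * d z = 0"
    proof -
      have *: "z * (x / z - y / z) = x - y" for x y :: complex
        using z by (auto simp: right_diff_distrib)
      show ?thesis unfolding * d_def by (simp add: algebra_simps)
    qed
  qed
  then have "d z = 0" for z by simp
  then show ?thesis by (auto simp: d_def)
qed

lemma euler_resolvent_bounded_operator:
  assumes p: "1 \<le> p" and a: "Re a \<noteq> 1/p"
  shows "hardy_bounded_operator p (euler_resolvent p a)"
  unfolding hardy_bounded_operator_def
proof (intro conjI ballI allI exI[of _ "1 / \<bar>1/p - Re a\<bar>"])
  fix f assume f: "f \<in> hardy_space p"
  note F = euler_resolvent[OF f p a]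
  show "euler_resolvent p a f \<in> hardy_space p" by (rule F)
  show "hardy_norm p (euler_resolvent p a f) \<le> 1 / \<bar>1/p - Re a\<bar> * hardy_norm p f" using F(2) by simp
  show "euler_resolvent p a (\<lambda>z. c * f z) = (\<lambda>z. c * euler_resolvent p a f z)" for c
  proof (rule euler_resolvent_unique[OF hardy_space_mult(1)[OF f p] hardy_space_mult(1)[OF F(1) p]
      p a])
    fix z :: complex assume z: "0 < Im z"
    show "((\<lambda>z. c * euler_resolvent p a f z) has_field_derivative
        (c * f z - a * (c * euler_resolvent p a f z)) / z) (at z)"
      using DERIV_cmult[OF F(3)[OF z], of c] by (simp add: algebra_simps)
  qed
  fix g assume g: "g \<in> hardy_space p"
  note G = euler_resolvent[OF g p a]
  show "euler_resolvent p a (\<lambda>z. f z + g z) = (\<lambda>z. euler_resolvent p a f z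
      + euler_resolvent p a g z)"
  proof (rule euler_resolvent_unique[OF hardy_space_add(1)[OF f g p] hardy_space_add(1)[OF F(1)
      G(1) p] p a])
    fix z :: complex assume z: "0 < Im z"
    show "((\<lambda>z. euler_resolvent p a f z + euler_resolvent p a g z) has_field_derivative
        (f z + g z - a * (euler_resolvent p a f z + euler_resolvent p a g z)) / z) (at z)"
      using DERIV_add[OF F(3)[OF z] G(3)[OF z]] by (simp add: algebra_simps add_divide_distrib
          diff_divide_distrib)
  qed
qed

text \<open>
  The solution of \<open>z g' = f\<close> is a primitive of the integrand, and it vanishes at infinity by
  \<open>hardy_primitive_decay\<close>.
\<close>

lemma hardy_T_limit:
  assumes f: "f \<in> hardy_space p" and p: "1 \<le> p" and z: "0 < Im z"
  shows "((\<lambda>w. contour_integral (linepath z w) (\<lambda>\<zeta>. f \<zeta> / \<zeta>))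
      \<longlongrightarrow> - euler_resolvent p 0 f z) at_infinity_upper"
proof -
  let ?g = "euler_resolvent p 0 f"
  have a: "Re 0 \<noteq> 1/p" using p by simp
  note G = euler_resolvent[OF f p a]
  have g': "(?g has_field_derivative f z / z) (at z)" if "0 < Im z" for z
    using G(3)[OF that] by simp
  define M N where "M = hardy_norm p f + 1" and "N = hardy_norm p ?g + 1"
  have fM: "hardy_bound p f M" "0 < M" and gN: "hardy_bound p ?g N" "0 < N"
    using f G(1) p hardy_norm_nonneg[of p f] hardy_norm_nonneg[of p ?g]
    by (auto simp: hardy_bound_iff M_def N_def)
  have upper: "eventually (\<lambda>w. 0 < Im w) at_infinity_upper"
    by (simp add: at_infinity_upper_def eventually_inf_principal)
  have "filterlim cmod at_top at_infinity_upper"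
    unfolding at_infinity_upper_def by (rule filterlim_mono[OF filterlim_norm_at_top order_refl])
        simp
  then have "filterlim (\<lambda>w. cmod w * (1/2)) at_top at_infinity_upper"
    by (rule filterlim_at_top_mult_tendsto_pos[OF tendsto_const, rotated]) simp
  then have "((\<lambda>w. (cmod w * (1/2)) powr (- (1/p))) \<longlongrightarrow> 0) at_infinity_upper"
    using p by (intro tendsto_neg_powr) auto
  then have "((\<lambda>w. (2 * M + 5 * N) * (cmod w / 2) powr (- (1/p))) \<longlongrightarrow> 0) at_infinity_upper"
    by (intro tendsto_mult_right_zero) simp
  then have "(?g \<longlongrightarrow> 0) at_infinity_upper"
    by (rule Lim_null_comparison[rotated])
       (use upper in eventually_elim, rule hardy_primitive_decay[OF fM gN p g'])
  then have "((\<lambda>w. ?g w - ?g z) \<longlongrightarrow> 0 - ?g z) at_infinity_upper"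
    by (intro tendsto_diff tendsto_const)
  moreover have "\<forall>\<^sub>F w in at_infinity_upper. contour_integral (linepath z w) (\<lambda>\<zeta>. f \<zeta> / \<zeta>)
      = ?g w - ?g z"
    using upper
  proof eventually_elim
    fix w :: complex assume w: "0 < Im w"
    have "((\<lambda>\<zeta>. f \<zeta> / \<zeta>) has_contour_integral (?g (pathfinish (linepath z w)) - ?g (pathstart
        (linepath z w)))) (linepath z w)"
    proof (rule contour_integral_primitive)
      show "path_image (linepath z w) \<subseteq> upper_half_plane"
        using z w convex_upper_half_plane by (simp add: closed_segment_subset)
      show "(?g has_field_derivative f x / x) (at x within upper_half_plane)" if
          "x \<in> upper_half_plane" for x
        using that by (auto intro!: has_field_derivative_at_within g')
    qed simp
    then show "contour_integral (linepath z w) (\<lambda>\<zeta>. f \<zeta> / \<zeta>) = ?g w - ?g z"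
      by (simp add: contour_integral_unique)
  qed
  ultimately show ?thesis
    by (simp add: tendsto_cong)
qed

lemma hardy_T_eq:
  assumes f: "f \<in> hardy_space p" and p: "1 \<le> p"
  shows "hardy_T f = (\<lambda>z. - euler_resolvent p 0 f z)"
proof
  fix z
  have a: "Re 0 \<noteq> 1/p" using p by simp
  show "hardy_T f z = - euler_resolvent p 0 f z"
  proof (cases "0 < Im z")
    case True
    then show ?thesis
      using tendsto_Lim[OF at_infinity_upper_neq_bot hardy_T_limit[OF f p True]]
          by (simp add: hardy_T_def)
  next
    case False
    then show ?thesis
      using euler_resolvent(1)[OF f p a] by (simp add: hardy_T_def hardy_space_def)
  qed
qed

lemma hardy_T_unique:
  assumes f: "f \<in> hardy_space p" and u: "u \<in> hardy_space p" and p: "1 \<le> p"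
    and u': "\<And>z. 0 < Im z \<Longrightarrow> (u has_field_derivative - f z / z) (at z)"
  shows "hardy_T f = u"
proof -
  have "euler_resolvent p 0 f = (\<lambda>z. - u z)"
  proof (rule euler_resolvent_unique[OF f _ p])
    show "(\<lambda>z. - u z) \<in> hardy_space p" using hardy_space_mult(1)[OF u p, of "- 1"] by simp
    show "((\<lambda>z. - u z) has_field_derivative (f z - 0 * - u z) / z) (at z)" if "0 < Im z" for z
      using DERIV_minus[OF u'[OF that]] by simp
  qed (use p in simp)
  then show ?thesis by (simp add: hardy_T_eq[OF f p])
qed

lemma hardy_T_euler:
  assumes f: "f \<in> hardy_space p" and p: "1 \<le> p"
  shows "hardy_T f \<in> hardy_space p" "hardy_norm p (hardy_T f) \<le> p * hardy_norm p f"
    "0 < Im z \<Longrightarrow> (hardy_T f has_field_derivative - f z / z) (at z)"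
proof -
  have a: "Re 0 \<noteq> 1/p" using p by simp
  note G = euler_resolvent[OF f p a]
  have eq: "hardy_T f = (\<lambda>z. - 1 * euler_resolvent p 0 f z)" by (simp add: hardy_T_eq[OF f p])
  show "hardy_T f \<in> hardy_space p" unfolding eq by (rule hardy_space_mult[OF G(1) p])
  have "hardy_norm p (hardy_T f) \<le> cmod (- 1) * hardy_norm p (euler_resolvent p 0 f)"
    unfolding eq by (rule hardy_space_mult[OF G(1) p])
  also have "\<dots> \<le> p * hardy_norm p f" using G(2) p by (simp add: mult.commute)
  finally show "hardy_norm p (hardy_T f) \<le> p * hardy_norm p f" .
  show "(hardy_T f has_field_derivative - f z / z) (at z)" if "0 < Im z"
    using DERIV_minus[OF G(3)[OF that]] by (simp add: hardy_T_eq[OF f p])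
qed

lemma hardy_T_bounded_operator:
  assumes p: "1 \<le> p"
  shows "hardy_bounded_operator p hardy_T"
proof -
  have a: "Re 0 \<noteq> 1/p" using p by simp
  have E: "hardy_bounded_operator p (euler_resolvent p 0)"
      by (rule euler_resolvent_bounded_operator[OF p a])
  show ?thesis
    unfolding hardy_bounded_operator_def
  proof (intro conjI ballI allI exI[of _ p])
    fix f c assume f: "f \<in> hardy_space p"
    show "hardy_T f \<in> hardy_space p" "hardy_norm p (hardy_T f) \<le> p * hardy_norm p f"
      by (rule hardy_T_euler[OF f p])+
    show "hardy_T (\<lambda>z. c * f z) = (\<lambda>z. c * hardy_T f z)"
      using E f by (simp add: hardy_T_eq[OF f p] hardy_T_eq[OF hardy_space_mult(1)[OF f p] p]
          hardy_bounded_operator_def)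
    fix g assume g: "g \<in> hardy_space p"
    show "hardy_T (\<lambda>z. f z + g z) = (\<lambda>z. hardy_T f z + hardy_T g z)"
      using E f g by (simp add: hardy_T_eq[OF _ p] hardy_space_add(1)[OF f g p]
          hardy_bounded_operator_def)
  qed
qed

lemma on_circle_iff_Re_inverse:
  fixes w :: complex and p :: real
  assumes "w \<noteq> 0" "0 < p"
  shows "cmod (w - complex_of_real (p / 2)) = p / 2 \<longleftrightarrow> Re (1 / w) = 1 / p"
proof -
  have n: "0 < (Re w)\<^sup>2 + (Im w)\<^sup>2"
    using assms(1) by (simp add: complex_eq_iff sum_power2_gt_zero_iff)
  have "cmod (w - complex_of_real (p / 2)) = p / 2 \<longleftrightarrow> (cmod (w - complex_of_real (p / 2)))\<^sup>2
      = (p / 2)\<^sup>2"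
    using assms(2) by (simp add: power2_eq_iff_nonneg)
  also have "\<dots> \<longleftrightarrow> (Re w)\<^sup>2 + (Im w)\<^sup>2 = p * Re w"
    unfolding cmod_power2 by (auto simp: power2_eq_square algebra_simps)
  also have "\<dots> \<longleftrightarrow> Re (1 / w) = 1 / p"
    using n assms by (auto simp: Re_divide field_simps complex_eq_iff)
  finally show ?thesis .
qed

text \<open>
  With \<open>G\<close> the resolvent for \<open>a = 1 / w\<close>, the inverse of \<open>w - T\<close> is \<open>R f = a f - a\<^sup>2 G f\<close>. Both
  identities follow from uniqueness for the Euler equation, once \<open>G (w f - T f) = - w T f\<close> and
  \<open>T (R f) = - a G f\<close> are guessed.
\<close>

lemma off_circle_not_in_hardy_spectrum_T:
  assumes p: "1 \<le> p" and w: "w \<noteq> 0" "Re (1 / w) \<noteq> 1 / p"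
  shows "w \<notin> hardy_spectrum p hardy_T"
proof -
  define a where "a = 1 / w"
  have wa: "w * a = 1" and a: "Re a \<noteq> 1 / p" using w by (auto simp: a_def)
  let ?G = "euler_resolvent p a"
  define R where "R = (\<lambda>f z. a * f z + (- a\<^sup>2) * ?G f z)"
  note G = euler_resolvent[OF _ p a]
  have GB: "hardy_bounded_operator p ?G" by (rule euler_resolvent_bounded_operator[OF p a])
  have RH: "R f \<in> hardy_space p" if "f \<in> hardy_space p" for f
    unfolding R_def using that by (intro hardy_space_add hardy_space_mult G p)
  have "hardy_bounded_operator p R"
    unfolding hardy_bounded_operator_def
  proof (intro conjI ballI allI exI[of _ "4 * max (cmod a) (cmod (- a\<^sup>2) * (1 / \<bar>1/p - Re a\<bar>))"] RH)
    fix f c assume f: "f \<in> hardy_space p"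
    let ?c = "max (cmod a) (cmod (- a\<^sup>2) * (1 / \<bar>1/p - Re a\<bar>))"
    have n: "0 \<le> hardy_norm p f" using hardy_norm_nonneg f p by simp
    have "hardy_norm p (R f) \<le> 4 * max (hardy_norm p (\<lambda>z. a * f z)) (hardy_norm p (\<lambda>z. (- a\<^sup>2) *
        ?G f z))"
      unfolding R_def by (intro hardy_space_add hardy_space_mult G f p)
    also have "\<dots> \<le> 4 * (?c * hardy_norm p f)"
    proof -
      have "hardy_norm p (\<lambda>z. a * f z) \<le> cmod a * hardy_norm p f" by (rule hardy_space_mult[OF f p])
      also have "\<dots> \<le> ?c * hardy_norm p f" using n by (intro mult_right_mono) auto
      finally have 1: "hardy_norm p (\<lambda>z. a * f z) \<le> ?c * hardy_norm p f" .
      have "hardy_norm p (\<lambda>z. (- a\<^sup>2) * ?G f z) \<le> cmod (- a\<^sup>2) * hardy_norm p (?G f)"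
        by (rule hardy_space_mult[OF G(1)[OF f] p])
      also have "\<dots> \<le> cmod (- a\<^sup>2) * (hardy_norm p f / \<bar>1/p - Re a\<bar>)"
        by (intro mult_left_mono G(2)[OF f]) auto
      also have "\<dots> = cmod (- a\<^sup>2) * (1 / \<bar>1/p - Re a\<bar>) * hardy_norm p f" by simp
      also have "\<dots> \<le> ?c * hardy_norm p f" using n by (intro mult_right_mono) auto
      finally show ?thesis using 1 by simp
    qed
    finally show "hardy_norm p (R f) \<le> 4 * ?c * hardy_norm p f" by (simp only: mult.assoc)
    show "R (\<lambda>z. c * f z) = (\<lambda>z. c * R f z)"
      using GB f by (simp add: R_def hardy_bounded_operator_def algebra_simps)
    fix g assume g: "g \<in> hardy_space p"
    show "R (\<lambda>z. f z + g z) = (\<lambda>z. R f z + R g z)"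
      using GB f g by (simp add: R_def hardy_bounded_operator_def algebra_simps)
  qed
  moreover have "R (\<lambda>z. w * f z - hardy_T f z) = f \<and> (\<lambda>z. w * R f z - hardy_T (R f) z) = f"
    if f: "f \<in> hardy_space p" for f
  proof
    note T = hardy_T_euler[OF f p]
    let ?h = "\<lambda>z. w * f z - hardy_T f z"
    have aw: "a * (w * x) = x" for x using wa by (simp add: mult.assoc[symmetric] mult.commute)
    have h: "?h \<in> hardy_space p" by (intro hardy_space_diff hardy_space_mult f T p)
    have "?G ?h = (\<lambda>z. (- w) * hardy_T f z)"
    proof (rule euler_resolvent_unique[OF h hardy_space_mult(1)[OF T(1) p] p a])
      fix z :: complex assume z: "0 < Im z"
      have "((\<lambda>z. (- w) * hardy_T f z) has_field_derivative (- w) * (- f z / z)) (at z)"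
        by (rule DERIV_cmult[OF T(3)[OF z]])
      moreover have "(- w) * (- f z / z) = (?h z - a * ((- w) * hardy_T f z)) / z"
        by (simp add: aw)
      ultimately show "((\<lambda>z. (- w) * hardy_T f z) has_field_derivative (?h z - a * ((- w) *
          hardy_T f z)) / z) (at z)"
        by (rule DERIV_cong)
    qed
    then show "R ?h = f"
      by (simp add: R_def fun_eq_iff right_diff_distrib aw power2_eq_square mult.assoc)
    have "hardy_T (R f) = (\<lambda>z. (- a) * ?G f z)"
    proof (rule hardy_T_unique[OF RH[OF f] hardy_space_mult(1)[OF G(1)[OF f] p] p])
      fix z :: complex assume z: "0 < Im z"
      have "((\<lambda>z. (- a) * ?G f z) has_field_derivative (- a) * ((f z - a * ?G f z) / z)) (at z)"
        by (rule DERIV_cmult[OF G(3)[OF f z]])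
      moreover have "(- a) * ((f z - a * ?G f z) / z) = - R f z / z"
        by (simp add: R_def power2_eq_square algebra_simps)
      ultimately show "((\<lambda>z. (- a) * ?G f z) has_field_derivative - R f z / z) (at z)"
        by (rule DERIV_cong)
    qed
    moreover have "w * (a * x + (- a\<^sup>2) * y) - (- a) * y = x" for x y
    proof -
      have "w * (a * x + (- a\<^sup>2) * y) - (- a) * y = (w * a) * x - (w * a) * (a * y) + a * y"
        by (simp add: power2_eq_square algebra_simps)
      then show ?thesis by (simp add: wa)
    qed
    ultimately show "(\<lambda>z. w * R f z - hardy_T (R f) z) = f"
      by (simp only: R_def)
  qed
  ultimately show ?thesis
    unfolding hardy_spectrum_def by blast
qed

section \<open>Almost eigenfunctions\<close>

lemma hardy_space_dominated:
  assumes f: "f \<in> hardy_space p" and g: "g holomorphic_on upper_half_plane"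
      "\<And>z. \<not> 0 < Im z \<Longrightarrow> g z = 0"
    and le: "\<And>z. 0 < Im z \<Longrightarrow> cmod (g z) \<le> c * cmod (f z)" and c: "0 \<le> c" and p: "1 \<le> p"
  shows "g \<in> hardy_space p" "hardy_norm p g \<le> c * hardy_norm p f"
  using hardy_bound_dominated[of p f "hardy_norm p f" g c] assms by (auto simp: hardy_bound_iff)

text \<open>
  On the positive axis the function is the derivative of the bounded function
  \<open>arctan (x powr e) / e\<close>.
\<close>

lemma integrable_two_sided_power:
  fixes e :: real
  assumes e: "0 < e"
  shows "integrable lborel (\<lambda>x. \<bar>x\<bar> powr (e - 1) / (1 + \<bar>x\<bar> powr (2 * e)))"
proof -
  let ?w = "\<lambda>x. x powr (e - 1) / (1 + x powr (2 * e))"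
  have "set_integrable lborel (einterval 0 \<infinity>) ?w"
  proof (rule interval_integral_FTC_nonneg)
    fix x :: real assume "0 < ereal x"
    then have x: "0 < x" by simp
    have sq: "(x powr e)\<^sup>2 = x powr (2 * e)" by (simp add: power2_eq_square powr_add[symmetric])
    have pos: "0 < 1 + x powr (2 * e)" by (simp add: add_pos_nonneg)
    show "((\<lambda>x. arctan (x powr e) / e) has_real_derivative ?w x) (at x)"
    proof (rule DERIV_cong)
      show "((\<lambda>x. arctan (x powr e) / e) has_real_derivative inverse (1
          + (x powr e)\<^sup>2) * (e * x powr (e - 1)) / e) (at x)"
        by (rule DERIV_cdivide[OF DERIV_chain2[OF DERIV_arctan has_real_derivative_powr[OF x]]])
      show "inverse (1 + (x powr e)\<^sup>2) * (e * x powr (e - 1)) / e = ?w x"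
        using e by (simp add: sq divide_inverse)
    qed
    show "isCont ?w x" using x pos by (intro continuous_intros) auto
  next
    show "AE x in lborel. 0 < ereal x \<longrightarrow> ereal x < \<infinity> \<longrightarrow> 0 \<le> ?w x" by simp
    have "((\<lambda>x::real. arctan (x powr e) / e) \<longlongrightarrow> arctan 0 / e) (at_right 0)"
      by (intro tendsto_intros tendsto_zero_powrI) (use e in \<open>auto simp: eventually_at_right_less
          intro!: tendsto_ident_at eventually_at_right_less[THEN eventually_mono]\<close>)
    then show "(((\<lambda>x. arctan (x powr e) / e) \<circ> real_of_ereal) \<longlongrightarrow> arctan 0 / e) (at_right 0)"
      by (simp add: zero_ereal_def ereal_tendsto_simps)
    have "filterlim (\<lambda>x::real. exp (e * ln x)) at_top at_top"
      by (intro filterlim_compose[OF exp_at_top] filterlim_tendsto_pos_mult_at_top[OF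
          tendsto_const e ln_at_top])
    moreover have "\<forall>\<^sub>F x::real in at_top. exp (e * ln x) = x powr e"
      using eventually_gt_at_top[of "0::real"] by eventually_elim (simp add: powr_def)
    ultimately have top: "filterlim (\<lambda>x::real. x powr e) at_top at_top"
      by (simp add: filterlim_cong)
    have "((\<lambda>x::real. arctan (x powr e) / e) \<longlongrightarrow> (pi / 2) / e) at_top"
      by (intro tendsto_divide filterlim_compose[OF tendsto_arctan_at_top top] tendsto_const)
          (use e in auto)
    then show "(((\<lambda>x. arctan (x powr e) / e) \<circ> real_of_ereal) \<longlongrightarrow> (pi / 2) / e) (at_left \<infinity>)"
      by (simp add: ereal_tendsto_simps)
  qed simp
  moreover have "einterval 0 \<infinity> = {0::real<..}" by (auto simp: einterval_def)
  ultimately have W: "integrable lborel (\<lambda>x. indicator {0<..} x *\<^sub>R ?w x)"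
    by (simp add: set_integrable_def)
  have W': "integrable lborel (\<lambda>x. indicator {0<..} (0 + (- 1) * x) *\<^sub>R ?w (0 + (- 1) * x))"
    by (rule lborel_integrable_real_affine[OF W]) simp
  have "\<bar>x\<bar> powr (e - 1) / (1 + \<bar>x\<bar> powr (2 * e))
      = indicator {0<..} x *\<^sub>R ?w x + indicator {0<..} (0 + (- 1) * x) *\<^sub>R ?w (0
          + (- 1) * x)" for x :: real
    by (cases x "0::real" rule: linorder_cases) auto
  then show ?thesis
    using Bochner_Integration.integrable_add[OF W W'] by simp
qed

lemma cmod_cpow_le:
  assumes "0 < Im z"
  shows "cmod (cpow b z) \<le> exp (\<bar>Im b\<bar> * pi) * cmod z powr Re b"
proof -
  have z: "z \<noteq> 0" using assms by auto
  have "\<bar>Im (Ln z)\<bar> \<le> pi" using mpi_less_Im_Ln[OF z] Im_Ln_le_pi[OF z] by linarith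
  then have "\<bar>Im b * Im (Ln z)\<bar> \<le> \<bar>Im b\<bar> * pi" by (simp add: abs_mult mult_left_mono)
  then have "Re (b * Ln z) \<le> \<bar>Im b\<bar> * pi + Re b * ln (cmod z)"
    using z by (simp add: Re_Ln abs_le_iff)
  then have "cmod (cpow b z) \<le> exp (\<bar>Im b\<bar> * pi + Re b * ln (cmod z))"
    by (simp add: cpow_def norm_exp_eq_Re)
  then show ?thesis using z by (simp add: exp_add powr_def)
qed

lemma cmod_cpow_of_real:
  assumes "0 < Im z"
  shows "cmod (cpow (of_real r) z) = cmod z powr r"
  using assms by (auto simp: cpow_def norm_exp_eq_Re Re_Ln powr_def)

text \<open>
  This is \<open>z\<^sup>-\<^sup>a (z / (z + \<i>)\<^sup>2)\<^sup>\<delta>\<close>. The power \<open>z\<^sup>-\<^sup>a\<close> with \<open>Re a = 1 / p\<close> is an eigenfunction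
  of the Euler operator that just fails to be in \<open>H\<^sup>p\<close>, at \<open>0\<close> and at \<open>\<infinity>\<close>; the second factor is
  of order \<open>\<bar>z\<bar>\<^sup>\<delta>\<close> at \<open>0\<close> and \<open>\<bar>z\<bar> powr (- \<delta>)\<close> at \<open>\<infinity>\<close>, which repairs both.
\<close>

definition near_eigenfunction :: "complex \<Rightarrow> real \<Rightarrow> complex \<Rightarrow> complex" where
  "near_eigenfunction a \<delta> z = (if 0 < Im z then cpow (of_real \<delta> - a) z * cpow (of_real (- 2 * \<delta>))
      (z + \<i>) else 0)"

lemma near_eigenfunction_deriv:
  assumes z: "0 < Im z"
  shows "(near_eigenfunction a \<delta> has_field_derivative
    near_eigenfunction a \<delta> z * (of_real \<delta> * ((\<i> - z) / (z + \<i>)) - a) / z) (at z)"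
proof -
  let ?b = "of_real \<delta> - a" and ?c = "of_real (- 2 * \<delta>) :: complex"
  have zi: "0 < Im (z + \<i>)" using z by simp
  have nz: "z \<noteq> 0" "z + \<i> \<noteq> 0"
    using z zi by (metis less_irrefl zero_complex.simps(2))+
  have "((\<lambda>z. cpow ?c (z + \<i>)) has_field_derivative ?c * cpow ?c (z + \<i>) / (z + \<i>) * 1) (at z)"
    by (rule DERIV_chain2[where f = "cpow ?c" and g = "\<lambda>z. z + \<i>", OF cpow_deriv[OF zi]])
       (auto intro!: derivative_eq_intros)
  from DERIV_mult[OF cpow_deriv[OF z, of ?b] this]
  have "((\<lambda>z. cpow ?b z * cpow ?c (z + \<i>)) has_field_derivative
      cpow ?b z * cpow ?c (z + \<i>) * (of_real \<delta> * ((\<i> - z) / (z + \<i>)) - a) / z) (at z)"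
  proof (rule DERIV_cong)
    define B C where "B = cpow ?b z" and "C = cpow ?c (z + \<i>)"
    show "?b * cpow ?b z / z * cpow ?c (z + \<i>) + ?c * cpow ?c (z + \<i>) / (z + \<i>) * 1 * cpow ?b z =
      cpow ?b z * cpow ?c (z + \<i>) * (of_real \<delta> * ((\<i> - z) / (z + \<i>)) - a) / z"
      unfolding B_def[symmetric] C_def[symmetric] using nz
          by (simp add: divide_simps) (simp add: algebra_simps)
  qed
  then have "(near_eigenfunction a \<delta> has_field_derivative
      cpow ?b z * cpow ?c (z + \<i>) * (of_real \<delta> * ((\<i> - z) / (z + \<i>)) - a) / z) (at z)"
    by (rule has_field_derivative_transform_within_open[OF _ open_upper_half_plane])
       (use z in \<open>auto simp: near_eigenfunction_def\<close>)
  then show ?thesis using z by (simp add: near_eigenfunction_def)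
qed

text \<open>
  With \<open>e = \<delta> p\<close>, the \<open>p\<close>-th power is at most a constant times
  \<open>\<bar>z\<bar> powr (e - 1) * \<bar>z + \<i>\<bar> powr (- 2 e)\<close>. From \<open>\<bar>z\<bar> \<ge> \<bar>x\<bar>\<close> and \<open>\<bar>z + \<i>\<bar> \<ge> max 1 \<bar>x\<bar>\<close> comes a
  majorant that is independent of the height.
\<close>

lemma near_eigenfunction_in_hardy_space:
  assumes p: "1 \<le> p" and a: "Re a = 1 / p" and \<delta>: "0 < \<delta>" "\<delta> * p < 1"
  shows "near_eigenfunction a \<delta> \<in> hardy_space p"
proof -
  define e where "e = \<delta> * p"
  have e: "0 < e" "e < 1" using \<delta> p by (auto simp: e_def)
  define C where "C = exp (\<bar>Im a\<bar> * pi) powr p * 2"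
  define V where "V = (\<lambda>x::real. C * (\<bar>x\<bar> powr (e - 1) / (1 + \<bar>x\<bar> powr (2 * e))))"
  have V: "integrable lborel V"
    unfolding V_def by (intro integrable_mult_right integrable_two_sided_power e)
  have "0 \<le> integral\<^sup>L lborel V"
    by (intro Bochner_Integration.integral_nonneg) (auto simp: V_def C_def intro!:
        mult_nonneg_nonneg divide_nonneg_nonneg add_nonneg_nonneg)
  then have N: "integral\<^sup>L lborel V = ((integral\<^sup>L lborel V) powr (1/p)) powr p"
    using p by (simp add: powr_powr)
  have le: "cmod (near_eigenfunction a \<delta> (Complex x y)) powr p \<le> V x" if y: "0 < y" and x:
      "x \<noteq> 0" for x y
  proof -
    let ?z = "Complex x y"
    have z: "0 < Im ?z" and zi: "0 < Im (?z + \<i>)" using y by auto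
    have xz: "\<bar>x\<bar> \<le> cmod ?z" using abs_Re_le_cmod[of ?z] by simp
    have xzi: "\<bar>x\<bar> \<le> cmod (?z + \<i>)" "1 \<le> cmod (?z + \<i>)"
      using abs_Re_le_cmod[of "?z + \<i>"] abs_Im_le_cmod[of "?z + \<i>"] y by auto
    have "cmod (near_eigenfunction a \<delta> ?z) \<le> exp (\<bar>Im a\<bar> * pi) * cmod ?z powr (\<delta> - 1/p) * cmod (?z
        + \<i>) powr (- 2 * \<delta>)"
      unfolding near_eigenfunction_def norm_mult using cmod_cpow_le[OF z, of
          "of_real \<delta> - a"] cmod_cpow_of_real[OF zi, of "- 2 * \<delta>"] z a
      by (simp add: norm_mult mult_right_mono)
    then have "cmod (near_eigenfunction a \<delta> ?z) powr p \<le>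
        (exp (\<bar>Im a\<bar> * pi) * cmod ?z powr (\<delta> - 1/p) * cmod (?z + \<i>) powr (- 2 * \<delta>)) powr p"
      using p by (intro powr_mono2) auto
    also have "\<dots> = exp (\<bar>Im a\<bar> * pi) powr p * cmod ?z powr (e - 1) * cmod (?z + \<i>) powr (- (2 * e))"
      using p by (simp add: powr_mult powr_powr e_def left_diff_distrib mult.assoc)
    also have "\<dots> \<le> exp (\<bar>Im a\<bar> * pi) powr p * \<bar>x\<bar> powr (e - 1) * (2 / (1 + \<bar>x\<bar> powr (2 * e)))"
    proof (intro mult_mono order_refl)
      show "cmod ?z powr (e - 1) \<le> \<bar>x\<bar> powr (e - 1)"
        using x xz e by (intro powr_mono2') auto
      have "1 powr (2 * e) \<le> cmod (?z + \<i>) powr (2 * e)"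
          "\<bar>x\<bar> powr (2 * e) \<le> cmod (?z + \<i>) powr (2 * e)"
        using xzi e by (auto intro!: powr_mono2 ge_one_powr_ge_zero)
      then have "1 + \<bar>x\<bar> powr (2 * e) \<le> 2 * cmod (?z + \<i>) powr (2 * e)" by simp
      moreover have "0 < 1 + \<bar>x\<bar> powr (2 * e)" "0 < cmod (?z + \<i>) powr (2 * e)"
        using xzi by (auto intro!: add_pos_nonneg)
      ultimately show "cmod (?z + \<i>) powr (- (2 * e)) \<le> 2 / (1 + \<bar>x\<bar> powr (2 * e))"
        by (simp add: powr_minus field_simps)
    qed auto
    also have "\<dots> = V x" by (simp add: V_def C_def)
    finally show ?thesis .
  qed
  have "hardy_bound p (near_eigenfunction a \<delta>) ((integral\<^sup>L lborel V) powr (1/p))"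
  proof (rule hardy_bound_if_le_integrable[where u = "\<lambda>_. V"])
    show "near_eigenfunction a \<delta> holomorphic_on upper_half_plane"
      unfolding holomorphic_on_open[OF open_upper_half_plane]
          by (auto intro!: exI near_eigenfunction_deriv)
    show "AE x in lborel. cmod (near_eigenfunction a \<delta> (Complex x y)) powr p \<le> V x" if "0 < y" for y
      using AE_lborel_singleton[of 0] by eventually_elim (use le that in auto)
    show "integral\<^sup>L lborel V \<le> ((integral\<^sup>L lborel V) powr (1/p)) powr p"
      using N by linarith
  qed (use V in \<open>auto simp: near_eigenfunction_def\<close>)
  then show ?thesis using p by (simp add: hardy_bound_iff)
qed

text \<open>
  Take \<open>f = z k'\<close>, so that \<open>T f = - k\<close>. The error is \<open>f + a k = \<delta> k (\<i> - z) / (z + \<i>)\<close>, and the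
  Cayley transform is bounded by \<open>1\<close> on the half-plane.
\<close>

lemma hardy_T_near_eigenfunction:
  assumes p: "1 \<le> p" and a: "Re a = 1 / p" and \<delta>: "0 < \<delta>" "\<delta> * p < 1"
  obtains f k where "f \<in> hardy_space p" "k \<in> hardy_space p" "0 < hardy_norm p k"
      "hardy_T f = (\<lambda>z. - k z)"
    "\<And>z. cmod (f z + a * k z) \<le> \<delta> * cmod (k z)"
proof -
  define k where "k = near_eigenfunction a \<delta>"
  define q where "q = (\<lambda>z. of_real \<delta> * ((\<i> - z) / (z + \<i>)))"
  define f where "f = (\<lambda>z. k z * (q z - a))"
  have k: "k \<in> hardy_space p" unfolding k_def by (rule near_eigenfunction_in_hardy_space[OF p a \<delta>])
  have k0: "k z = 0" if "\<not> 0 < Im z" for z using that by (simp add: k_def near_eigenfunction_def)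
  have q: "cmod (q z) \<le> \<delta>" if z: "0 < Im z" for z
  proof -
    have "(cmod (\<i> - z))\<^sup>2 \<le> (cmod (z + \<i>))\<^sup>2"
      unfolding cmod_power2 using z by (simp add: power2_eq_square algebra_simps)
    then have "cmod (\<i> - z) \<le> cmod (z + \<i>)" by (rule power2_le_imp_le) simp
    moreover have "z + \<i> \<noteq> 0" using z by (auto simp: complex_eq_iff)
    ultimately have "cmod ((\<i> - z) / (z + \<i>)) \<le> 1" by (simp add: norm_divide divide_le_eq)
    then show ?thesis using \<delta>(1) unfolding q_def norm_mult by (simp add: mult_left_le)
  qed
  have fk: "cmod (f z + a * k z) \<le> \<delta> * cmod (k z)" for z
  proof (cases "0 < Im z")
    case True
    have "f z + a * k z = k z * q z" by (simp add: f_def algebra_simps)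
    then show ?thesis using mult_left_mono[OF q[OF True], of
        "cmod (k z)"] by (simp add: norm_mult mult.commute)
  qed (simp add: f_def k0)
  have "f holomorphic_on upper_half_plane"
    unfolding f_def q_def using k
    by (intro holomorphic_intros) (auto simp: hardy_space_def complex_eq_iff)
  then have f: "f \<in> hardy_space p"
  proof (rule hardy_space_dominated(1)[OF k])
    fix z :: complex assume z: "0 < Im z"
    have "cmod (q z - a) \<le> \<delta> + cmod a" using q[OF z] norm_triangle_ineq4[of "q z" a] by linarith
    then show "cmod (f z) \<le> (\<delta> + cmod a) * cmod (k z)"
      unfolding f_def norm_mult by (simp add: mult.commute mult_left_mono)
  qed (use \<delta> p in \<open>auto simp: f_def k0\<close>)
  have "hardy_T f = (\<lambda>z. - k z)"
  proof (rule hardy_T_unique[OF f _ p])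
    show "(\<lambda>z. - k z) \<in> hardy_space p" using hardy_space_mult(1)[OF k p, of "- 1"] by simp
    show "((\<lambda>z. - k z) has_field_derivative - f z / z) (at z)" if "0 < Im z" for z
      using DERIV_minus[OF near_eigenfunction_deriv[OF that, of a \<delta>]]
          by (simp add: f_def q_def k_def)
  qed
  moreover have "k \<i> \<noteq> 0" by (simp add: k_def near_eigenfunction_def)
  ultimately show ?thesis
    using that[OF f k hardy_norm_pos[OF k p]] fk by blast
qed

lemma hardy_norm_near_eigenfunction:
  assumes f: "f \<in> hardy_space p" and k: "k \<in> hardy_space p" and p: "1 \<le> p" and \<delta>: "0 \<le> \<delta>"
    and fk: "\<And>z. cmod (f z + a * k z) \<le> \<delta> * cmod (k z)"
  shows "hardy_norm p f \<le> (cmod a + \<delta>) * hardy_norm p k"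
    and "(cmod a - \<delta>) * hardy_norm p k \<le> hardy_norm p f"
proof -
  note fD = f[unfolded hardy_space_def] and kD = k[unfolded hardy_space_def]
  show "hardy_norm p f \<le> (cmod a + \<delta>) * hardy_norm p k"
  proof (rule hardy_space_dominated(2)[OF k])
    show "cmod (f z) \<le> (cmod a + \<delta>) * cmod (k z)" for z
      using fk[of z] norm_triangle_ineq4[of "f z + a * k z"
          "a * k z"] by (simp add: norm_mult algebra_simps)
  qed (use fD \<delta> p in auto)
  show "(cmod a - \<delta>) * hardy_norm p k \<le> hardy_norm p f"
  proof (cases "\<delta> < cmod a")
    case True
    have "hardy_norm p k \<le> (1 / (cmod a - \<delta>)) * hardy_norm p f"
    proof (rule hardy_space_dominated(2)[OF f])
      fix z
      have "cmod (a * k z) \<le> cmod (f z + a * k z) + cmod (f z)"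
        using norm_triangle_ineq4[of "f z + a * k z" "f z"] by simp
      then have "(cmod a - \<delta>) * cmod (k z) \<le> cmod (f z)"
        using fk[of z] by (simp add: norm_mult algebra_simps)
      then show "cmod (k z) \<le> 1 / (cmod a - \<delta>) * cmod (f z)"
        using True by (simp add: field_simps)
    qed (use kD True p in auto)
    then show ?thesis using True by (simp add: field_simps)
  next
    case False
    then have "(cmod a - \<delta>) * hardy_norm p k \<le> 0"
      using hardy_norm_nonneg[OF _ k] p by (simp add: mult_nonpos_nonneg)
    then show ?thesis using hardy_norm_nonneg[OF _ f] p by simp
  qed
qed

section \<open>Norm and spectrum\<close>

lemma hardy_operator_norm_T:
  assumes p: "1 \<le> p"
  shows "hardy_operator_norm p hardy_T = p"
proof -
  let ?B = "{f \<in> hardy_space p. hardy_norm p f \<le> 1}"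
  define S where "S = hardy_operator_norm p hardy_T"
  have le: "hardy_norm p (hardy_T f) \<le> p" if "f \<in> ?B" for f
  proof -
    have "hardy_norm p (hardy_T f) \<le> p * hardy_norm p f" using that p by (intro hardy_T_euler) auto
    also have "\<dots> \<le> p * 1" using that p by (intro mult_left_mono) auto
    finally show ?thesis by simp
  qed
  then have bdd: "bdd_above ((\<lambda>f. hardy_norm p (hardy_T f)) ` ?B)" by (auto intro!: bdd_aboveI2)
  have lower: "1 \<le> S * (1/p + \<delta>)" if \<delta>: "0 < \<delta>" "\<delta> * p < 1" for \<delta>
  proof -
    have "Re (of_real (1/p)) = 1/p" by simp
    then obtain f k where fk: "f \<in> hardy_space p" "k \<in> hardy_space p" "0 < hardy_norm p k"
      "hardy_T f = (\<lambda>z. - k z)" "\<And>z. cmod (f z + of_real (1/p) * k z) \<le> \<delta> * cmod (k z)"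
      using hardy_T_near_eigenfunction[OF p _ \<delta>] by metis
    have fle: "hardy_norm p f \<le> (1/p + \<delta>) * hardy_norm p k"
      using hardy_norm_near_eigenfunction(1)[OF fk(1,2) p _ fk(5)] \<delta> p by (simp add: norm_divide)
    define b where "b = (1/p + \<delta>) * hardy_norm p k"
    have b: "0 < b" using fk(3) \<delta> p by (simp add: b_def add_pos_pos)
    define c where "c = complex_of_real (1 / b)"
    have cb: "cmod c = 1 / b" using b by (simp add: c_def norm_divide)
    have F: "(\<lambda>z. c * f z) \<in> hardy_space p" by (rule hardy_space_mult[OF fk(1) p])
    have "hardy_norm p (\<lambda>z. c * f z) \<le> cmod c * hardy_norm p f"
        by (rule hardy_space_mult[OF fk(1) p])
    also have "\<dots> \<le> 1" using fle b by (simp add: cb b_def[symmetric])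
    finally have FB: "(\<lambda>z. c * f z) \<in> ?B" using F by simp
    have TF: "hardy_T (\<lambda>z. c * f z) = (\<lambda>z. c * - k z)"
      using hardy_T_bounded_operator[OF p] fk(1,4) by (simp add: hardy_bounded_operator_def)
    have cnz: "c \<noteq> 0" using b by (simp add: c_def)
    have "hardy_norm p k \<le> cmod (- inverse c) * hardy_norm p (\<lambda>z. c * - k z)"
      using hardy_space_mult(2)[OF hardy_T_euler(1)[OF F p] p, of "- inverse c"] cnz
      by (simp add: TF mult.assoc[symmetric])
    also have "\<dots> \<le> b * S"
    proof -
      have "hardy_norm p (\<lambda>z. c * - k z) \<le> S"
        using cSUP_upper[OF FB bdd] by (simp add: S_def hardy_operator_norm_def TF)
      moreover have "cmod (- inverse c) = b" using b by (simp add: norm_inverse cb)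
      ultimately show ?thesis using b by (simp add: mult_left_mono)
    qed
    finally have "hardy_norm p k * 1 \<le> hardy_norm p k * (S * (1/p + \<delta>))"
        by (simp add: b_def algebra_simps)
    then show ?thesis using fk(3) by (simp only: mult_le_cancel_left_pos)
  qed
  have "(\<lambda>_. 0) \<in> ?B"
    using p hardy_bound_iff[of p "\<lambda>_. 0" 0] by (simp add: hardy_bound_def)
  then have "S \<le> p"
    unfolding S_def hardy_operator_norm_def by (intro cSUP_least le) auto
  moreover have "p \<le> S"
  proof (rule field_le_epsilon)
    fix \<epsilon> :: real assume \<epsilon>: "0 < \<epsilon>"
    \<comment> \<open>small enough for the almost eigenfunction to exist, and for the loss \<open>S \<delta> p \<le> p \<delta> p\<close> to be at most \<open>\<epsilon>\<close>\<close>
    define \<delta> where "\<delta> = min (1 / (2 * p)) (\<epsilon> / (p * p))"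
    have \<delta>: "0 < \<delta>" "\<delta> * p < 1" "\<delta> * p * p \<le> \<epsilon>"
    proof -
      show "0 < \<delta>" using p \<epsilon> by (simp add: \<delta>_def)
      have "\<delta> * p \<le> 1 / (2 * p) * p" using p unfolding \<delta>_def by (intro mult_right_mono) auto
      then show "\<delta> * p < 1" using p by simp
      have "\<delta> * (p * p) \<le> \<epsilon> / (p * p) * (p * p)" using p unfolding \<delta>_def
          by (intro mult_right_mono) auto
      then show "\<delta> * p * p \<le> \<epsilon>" using p by (simp add: mult.assoc)
    qed
    have "p * 1 \<le> p * (S * (1/p + \<delta>))" using lower[OF \<delta>(1,2)] p by (intro mult_left_mono) auto
    also have "\<dots> = S + S * (\<delta> * p)" using p by (simp add: field_simps)
    also have "S * (\<delta> * p) \<le> p * (\<delta> * p)" using \<open>S \<le> p\<close> \<delta> p by (intro mult_right_mono) auto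
    also have "p * (\<delta> * p) \<le> \<epsilon>" using \<delta>(3) by (simp add: mult_ac)
    finally show "p \<le> S + \<epsilon>" by simp
  qed
  ultimately show ?thesis by (simp add: S_def)
qed

text \<open>
  A bounded inverse of \<open>w - T\<close>, of norm at most \<open>C\<close>, would bound \<open>\<parallel>f\<parallel>\<close> by \<open>C \<parallel>w f + k\<parallel>\<close> for all
  pairs \<open>f \<approx> - a k\<close> of \<open>hardy_T_near_eigenfunction\<close>. If \<open>w = 1 / a\<close> then \<open>w f + k\<close> is of size
  \<open>\<delta>\<close> relative to \<open>k\<close>, while \<open>f\<close> is not. If \<open>w = 0\<close> then \<open>w f + k = k\<close>, while \<open>f\<close> exceeds \<open>k\<close> by
  a factor of about \<open>\<bar>a\<bar>\<close>, which is arbitrarily large.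
\<close>

lemma circle_subset_hardy_spectrum_T:
  assumes p: "1 \<le> p" and w: "w = 0 \<or> Re (1 / w) = 1 / p"
  shows "w \<in> hardy_spectrum p hardy_T"
proof (rule ccontr)
  assume "w \<notin> hardy_spectrum p hardy_T"
  then obtain R where R: "hardy_bounded_operator p R"
    and inv: "\<And>f. f \<in> hardy_space p \<Longrightarrow> R (\<lambda>z. w * f z - hardy_T f z) = f"
    unfolding hardy_spectrum_def by blast
  obtain C0 where C0: "\<And>f. f \<in> hardy_space p \<Longrightarrow> hardy_norm p (R f) \<le> C0 * hardy_norm p f"
    using R unfolding hardy_bounded_operator_def by blast
  define C where "C = \<bar>C0\<bar>"
  have C: "0 \<le> C" "hardy_norm p (R f) \<le> C * hardy_norm p f" if "f \<in> hardy_space p" for f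
    using order_trans[OF C0[OF that] mult_right_mono[OF abs_ge_self[of C0] hardy_norm_nonneg[OF _
        that]]] p
    by (auto simp: C_def)
  have key: "cmod a - \<delta> \<le> C * c" if a: "Re a = 1/p" and \<delta>: "0 < \<delta>" "\<delta> * p < 1" and c: "0 \<le> c"
    and u: "\<And>x y. cmod (x + a * y) \<le> \<delta> * cmod y \<Longrightarrow> cmod (w * x + y) \<le> c * cmod y" for a \<delta> c
  proof -
    obtain f k where fk: "f \<in> hardy_space p" "k \<in> hardy_space p" "0 < hardy_norm p k"
      "hardy_T f = (\<lambda>z. - k z)" "\<And>z. cmod (f z + a * k z) \<le> \<delta> * cmod (k z)"
      using hardy_T_near_eigenfunction[OF p a \<delta>] by metis
    define v where "v = (\<lambda>z. w * f z - hardy_T f z)"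
    have v: "v z = w * f z + k z" for z by (simp add: v_def fk(4))
    have vH: "v \<in> hardy_space p"
      unfolding v_def by (intro hardy_space_diff hardy_space_mult hardy_T_euler fk p)
    have "hardy_norm p v \<le> c * hardy_norm p k"
      by (rule hardy_space_dominated(2)[OF fk(2)])
          (use vH u fk(5) c p in \<open>auto simp: hardy_space_def v\<close>)
    moreover have "hardy_norm p f \<le> C * hardy_norm p v"
      using C(2)[OF vH] inv[OF fk(1)] by (simp add: v_def)
    moreover have "(cmod a - \<delta>) * hardy_norm p k \<le> hardy_norm p f"
      using hardy_norm_near_eigenfunction(2)[OF fk(1,2) p _ fk(5)] \<delta> by simp
    ultimately have "(cmod a - \<delta>) * hardy_norm p k \<le> C * (c * hardy_norm p k)"
      using mult_left_mono[of "hardy_norm p v" "c * hardy_norm p k" C] by (simp add: C_def)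
    then have "hardy_norm p k * (cmod a - \<delta>) \<le> hardy_norm p k * (C * c)" by (simp add: mult_ac)
    then show ?thesis using fk(3) by (simp only: mult_le_cancel_left_pos)
  qed
  show False
  proof (cases "w = 0")
    case True
    define a where "a = Complex (1/p) (C + 1)"
    have "cmod a - 1 / (2 * p) \<le> C * 1"
      by (rule key) (use p True in \<open>auto simp: a_def\<close>)
    moreover have "C + 1 \<le> cmod a" using abs_Im_le_cmod[of a] by (simp add: a_def C_def)
    moreover have "1 / (2 * p) < 1" using p by simp
    ultimately show False by simp
  next
    case False
    define a where "a = 1 / w"
    have a: "Re a = 1/p" "a \<noteq> 0" "w * a = 1" using w False by (auto simp: a_def)
    define \<delta> where "\<delta> = min (1 / (2 * p)) (cmod a / (2 * (1 + C * cmod w)))"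
    have D: "0 < 1 + C * cmod w" by (simp add: C_def add_pos_nonneg)
    have \<delta>: "0 < \<delta>" "\<delta> * p < 1" "\<delta> * (1 + C * cmod w) \<le> cmod a / 2"
    proof -
      show "0 < \<delta>" using p a D by (simp add: \<delta>_def)
      have "\<delta> * p \<le> 1 / (2 * p) * p" using p unfolding \<delta>_def by (intro mult_right_mono) auto
      then show "\<delta> * p < 1" using p by simp
      have "\<delta> * (1 + C * cmod w) \<le> cmod a / (2 * (1 + C * cmod w)) * (1 + C * cmod w)"
        using D unfolding \<delta>_def by (intro mult_right_mono) auto
      also have "\<dots> = cmod a / 2"
      proof -
        have "x / (2 * d) * d = x / 2" if "0 < d" for x d :: real using that
            by (simp add: field_simps)
        from this[OF D] show ?thesis .
      qed
      finally show "\<delta> * (1 + C * cmod w) \<le> cmod a / 2" .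
    qed
    have "cmod a - \<delta> \<le> C * (cmod w * \<delta>)"
    proof (rule key[OF a(1) \<delta>(1,2)])
      fix x y assume le: "cmod (x + a * y) \<le> \<delta> * cmod y"
      have "w * x + y = w * (x + a * y)" using a(3)
          by (simp add: distrib_left mult.assoc[symmetric])
      then show "cmod (w * x + y) \<le> cmod w * \<delta> * cmod y"
        using mult_left_mono[OF le, of "cmod w"] by (simp add: norm_mult mult.assoc)
    qed (use \<delta> in simp)
    then have "cmod a \<le> \<delta> * (1 + C * cmod w)" by (simp add: algebra_simps)
    with \<delta>(3) show False using a(2) zero_less_norm_iff[of a] by linarith
  qed
qed

theorem theorem3p2:
  fixes p :: real
  assumes "1 \<le> p"
  shows "(\<forall>f\<in>hardy_space p. \<forall>z\<in>upper_half_plane.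
            \<exists>L. ((\<lambda>w. contour_integral (linepath z w) (\<lambda>\<zeta>. f \<zeta> / \<zeta>)) \<longlongrightarrow> L)
                 at_infinity_upper)
       \<and> hardy_bounded_operator p hardy_T
       \<and> hardy_operator_norm p hardy_T = p
       \<and> hardy_spectrum p hardy_T = {w. cmod (w - complex_of_real (p / 2)) = p / 2}"
proof (intro conjI ballI)
  fix f z assume "f \<in> hardy_space p" "z \<in> upper_half_plane"
  then show "\<exists>L. ((\<lambda>w. contour_integral (linepath z w) (\<lambda>\<zeta>. f \<zeta> / \<zeta>)) \<longlongrightarrow> L) at_infinity_upper"
    using hardy_T_limit[OF _ assms] by auto
next
  show "hardy_bounded_operator p hardy_T" by (rule hardy_T_bounded_operator[OF assms])
  show "hardy_operator_norm p hardy_T = p" by (rule hardy_operator_norm_T[OF assms])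
  have "w \<in> hardy_spectrum p hardy_T \<longleftrightarrow> cmod (w - complex_of_real (p / 2)) = p / 2" for w
  proof (cases "w = 0")
    case True
    then show ?thesis
      using circle_subset_hardy_spectrum_T[OF assms, of 0] assms by (simp add: norm_minus_commute)
  next
    case False
    then show ?thesis
      using circle_subset_hardy_spectrum_T[OF assms, of w] off_circle_not_in_hardy_spectrum_T[OF assms, of w]
        on_circle_iff_Re_inverse[of w p] assms by auto
  qed
  then show "hardy_spectrum p hardy_T = {w. cmod (w - complex_of_real (p / 2)) = p / 2}"
    by auto
qed

end
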